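(* Let $t\ge 1$ be an integer. Then there exists $n_0=n_0(t)$ such that for every $n\ge n_0$ and every $Q_t$-minor-free graph $G$ of order $n$, $$\rho(G)\leq \rho(K_t\vee M_{n-t}),$$ with equality if and only if $G = K_t\vee M_{n-t}$ (up to isomorphism).
   Context: All graphs are finite and simple. $\rho(G)$ is the spectral radius of $G$, i.e. the largest eigenvalue of its adjacency matrix. $K_t$ is the complete graph on $t$ vertices. The join $G_1\vee G_2$ of two disjoint graphs is obtained from their vertex-disjoint union by joining each vertex of $G_1$ to each vertex of $G_2$. $M_m$ is the graph on $m$ vertices that is the disjoint union of $\lfloor m/2\rfloor$ copies of $K_2$ and $\lceil m/2\rceil-\lfloor m/2\rfloor$ isolated vertices (so one isolated vertex if $m$ is odd, none if $m$ is even). $Q_t$ is the graph obtained from $t$ copies of the 4-cycle $C_4$ by sharing one common vertex (the copies being otherwise vertex-disjoint). A graph $H$ is a minor of $G$ if a graph isomorphic to $H$ can be obtained from $G$ by vertex deletions, edge deletions and edge contractions; $G$ is $H$-minor-free if it does not contain $H$ as a minor. *)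

theory Defs
  imports
    "Graph_Theory.Pair_Digraph"
    "Graph_Theory.Digraph_Isomorphism"
    "Jordan_Normal_Form.Spectral_Radius"
begin

text \<open>
  Finite simple graphs are \<^locale>\<open>pair_graph\<close>s: finite, loop-free, symmetric digraphs whose arcs
  are pairs of vertices; the edge \<open>uv\<close> is represented by the two arcs \<open>(u,v)\<close> and \<open>(v,u)\<close>.
\<close>

abbreviation graph_iso :: "'a pair_pre_digraph \<Rightarrow> 'b pair_pre_digraph \<Rightarrow> bool"
    (infix \<open>\<cong>\<^sub>g\<close> 50) where
  "G \<cong>\<^sub>g H \<equiv> digraph_iso (with_proj G) (with_proj H)"

subsection \<open>Spectral radius\<close>

definition vertex_list :: "'a pair_pre_digraph \<Rightarrow> 'a list" where
  "vertex_list G = (SOME vs. distinct vs \<and> set vs = pverts G)"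

definition adj_matrix_wrt :: "'a pair_pre_digraph \<Rightarrow> 'a list \<Rightarrow> real mat" where
  "adj_matrix_wrt G vs =
     mat (length vs) (length vs) (\<lambda>(i, j). if (vs ! i, vs ! j) \<in> parcs G then 1 else 0)"

text \<open>
  The order of the vertices is arbitrary; by \<open>spectrum_adj_matrix\<close> below it does not affect the
  spectrum.
\<close>

definition adj_matrix :: "'a pair_pre_digraph \<Rightarrow> real mat" where
  "adj_matrix G = adj_matrix_wrt G (vertex_list G)"

text \<open>
  Only real eigenvalues are considered, which are all of them since the matrix is real symmetric.
  The value is meaningful only for graphs with at least one vertex.
\<close>

definition graph_spectral_radius :: "'a pair_pre_digraph \<Rightarrow> real" (\<open>\<rho>\<close>) where
  "\<rho> G = Max (spectrum (adj_matrix G))"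

subsection \<open>Particular graphs\<close>

definition complete_graph :: "nat \<Rightarrow> nat pair_pre_digraph" where
  "complete_graph t =
     \<lparr> pverts = {0..<t}, parcs = {(u, v). u \<in> {0..<t} \<and> v \<in> {0..<t} \<and> u \<noteq> v} \<rparr>"

definition matching_graph :: "nat \<Rightarrow> nat pair_pre_digraph" where
  "matching_graph m =
     (let E = {(2 * i, 2 * i + 1) | i. i < m div 2}
      in \<lparr> pverts = {0..<m}, parcs = E \<union> E\<inverse> \<rparr>)"

text \<open>The sum type makes the vertex sets disjoint.\<close>

definition graph_join ::
    "'a pair_pre_digraph \<Rightarrow> 'b pair_pre_digraph \<Rightarrow> ('a + 'b) pair_pre_digraph" where
  "graph_join G H =
     \<lparr> pverts = pverts G <+> pverts H,
       parcs = map_prod Inl Inl ` parcs G \<union> map_prod Inr Inr ` parcs H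
             \<union> (Inl ` pverts G) \<times> (Inr ` pverts H) \<union> (Inr ` pverts H) \<times> (Inl ` pverts G) \<rparr>"

text \<open>The shared vertex is \<open>0\<close>, and the \<open>i\<close>-th 4-cycle is \<open>0, 3i+1, 3i+2, 3i+3\<close>.\<close>

definition Q_graph :: "nat \<Rightarrow> nat pair_pre_digraph" where
  "Q_graph t =
     (let E = (\<Union>i<t. {(0, 3*i + 1), (3*i + 1, 3*i + 2), (3*i + 2, 3*i + 3), (3*i + 3, 0)})
      in \<lparr> pverts = {0..3 * t}, parcs = E \<union> E\<inverse> \<rparr>)"

subsection \<open>Minors\<close>

definition delete_vertex :: "'a \<Rightarrow> 'a pair_pre_digraph \<Rightarrow> 'a pair_pre_digraph" where
  "delete_vertex v G =
     \<lparr> pverts = pverts G - {v}, parcs = {(a, b) \<in> parcs G. a \<noteq> v \<and> b \<noteq> v} \<rparr>"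

definition delete_edge :: "'a \<Rightarrow> 'a \<Rightarrow> 'a pair_pre_digraph \<Rightarrow> 'a pair_pre_digraph" where
  "delete_edge u v G = \<lparr> pverts = pverts G, parcs = parcs G - {(u, v), (v, u)} \<rparr>"

text \<open>
  \<open>v\<close> is merged into \<open>u\<close>; the loop this creates is dropped, and parallel edges are identified
  because the arcs form a set.
\<close>

definition contract_edge :: "'a \<Rightarrow> 'a \<Rightarrow> 'a pair_pre_digraph \<Rightarrow> 'a pair_pre_digraph" where
  "contract_edge u v G =
     (let f = id(v := u)
      in \<lparr> pverts = pverts G - {v}, parcs = {(f a, f b) | a b. (a, b) \<in> parcs G \<and> f a \<noteq> f b} \<rparr>)"

inductive minor_step :: "'a pair_pre_digraph \<Rightarrow> 'a pair_pre_digraph \<Rightarrow> bool" where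
  delete_vertex: "v \<in> pverts G \<Longrightarrow> minor_step G (delete_vertex v G)"
| delete_edge: "(u, v) \<in> parcs G \<Longrightarrow> minor_step G (delete_edge u v G)"
| contract_edge: "(u, v) \<in> parcs G \<Longrightarrow> minor_step G (contract_edge u v G)"

definition is_minor :: "'b pair_pre_digraph \<Rightarrow> 'a pair_pre_digraph \<Rightarrow> bool" where
  "is_minor H G \<longleftrightarrow> (\<exists>G'. minor_step\<^sup>*\<^sup>* G G' \<and> H \<cong>\<^sub>g G')"

definition minor_free :: "'b pair_pre_digraph \<Rightarrow> 'a pair_pre_digraph \<Rightarrow> bool" where
  "minor_free H G \<longleftrightarrow> \<not> is_minor H G"

subsection \<open>Basic facts\<close>

lemma pair_graphI:
  assumes "finite (pverts G)" "parcs G \<subseteq> pverts G \<times> pverts G"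
    and "\<And>u v. (u, v) \<in> parcs G \<Longrightarrow> (v, u) \<in> parcs G" "\<And>u. (u, u) \<notin> parcs G"
  shows "pair_graph G"
proof -
  have "finite (parcs G)"
    using assms(1,2) by (meson finite_SigmaI finite_subset)
  with assms show ?thesis
    by unfold_locales (auto simp: symmetric_def intro!: symI)
qed

lemma pair_graphD:
  assumes "pair_graph G"
  shows "finite (pverts G)" "parcs G \<subseteq> pverts G \<times> pverts G"
    and "\<And>u v. (u, v) \<in> parcs G \<Longrightarrow> (v, u) \<in> parcs G" "\<And>u. (u, u) \<notin> parcs G"
proof -
  interpret pair_graph G by fact
  show "finite (pverts G)" by (rule pair_finite_verts)
  show "parcs G \<subseteq> pverts G \<times> pverts G" by (auto dest: in_arcsD1 in_arcsD2)
  show "\<And>u v. (u, v) \<in> parcs G \<Longrightarrow> (v, u) \<in> parcs G" by (rule arcs_symmetric)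
  show "\<And>u. (u, u) \<notin> parcs G" by (auto dest: no_loops')
qed

lemma pair_graph_complete: "pair_graph (complete_graph t)"
  by (rule pair_graphI) (auto simp: complete_graph_def)

lemma pair_graph_matching: "pair_graph (matching_graph m)"
  by (rule pair_graphI) (auto simp: matching_graph_def Let_def)

lemma pair_graph_Q: "pair_graph (Q_graph t)"
  by (rule pair_graphI) (auto simp: Q_graph_def Let_def)

lemma pair_graph_join:
  assumes "pair_graph G" "pair_graph H"
  shows "pair_graph (graph_join G H)"
  using pair_graphD[OF assms(1)] pair_graphD[OF assms(2)]
  by (intro pair_graphI) (auto simp: graph_join_def)

lemma pair_graph_minor_step:
  assumes "minor_step G G'" "pair_graph G"
  shows "pair_graph G'"
  using assms(1)
proof cases
  case (delete_vertex v)
  then show ?thesis using pair_graphD[OF assms(2)]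
    by (intro pair_graphI) (auto simp: delete_vertex_def)
next
  case (delete_edge u v)
  then show ?thesis using pair_graphD[OF assms(2)]
    by (intro pair_graphI) (auto simp: delete_edge_def)
next
  case (contract_edge u v)
  then show ?thesis using pair_graphD[OF assms(2)]
    apply (intro pair_graphI)
       apply (auto simp: contract_edge_def Let_def split: if_splits)
    by metis+
qed

lemma vertex_list:
  assumes "pair_graph G"
  shows "distinct (vertex_list G)" "set (vertex_list G) = pverts G"
proof -
  have "\<exists>vs. distinct vs \<and> set vs = pverts G"
    using finite_distinct_list[OF pair_graphD(1)[OF assms]] by blast
  then show "distinct (vertex_list G)" "set (vertex_list G) = pverts G"
    unfolding vertex_list_def by (metis (mono_tags, lifting) someI_ex)+
qed

lemma eigenvalue_adj_matrix_wrt: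
  assumes "distinct vs" "set vs = pverts G"
  shows "eigenvalue (adj_matrix_wrt G vs) k \<longleftrightarrow>
    (\<exists>x. (\<exists>v\<in>pverts G. x v \<noteq> 0) \<and>
         (\<forall>v\<in>pverts G. (\<Sum>w\<in>pverts G. if (v, w) \<in> parcs G then x w else 0) = k * x v))"
proof -
  let ?n = "length vs"
  have bij: "bij_betw ((!) vs) {0..<?n} (pverts G)"
    using bij_betw_nth[OF assms(1), of "{0..<?n}" "pverts G"] assms(2)
    by (simp add: lessThan_atLeast0)
  have mult: "(adj_matrix_wrt G vs *\<^sub>v y) $ i =
      (\<Sum>w\<in>pverts G. if (vs ! i, w) \<in> parcs G then x w else 0)"
    if i: "i < ?n" and y: "y \<in> carrier_vec ?n" and xy: "\<And>j. j < ?n \<Longrightarrow> x (vs ! j) = y $ j"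
    for i x and y :: "real vec"
  proof -
    have "(adj_matrix_wrt G vs *\<^sub>v y) $ i =
        (\<Sum>j=0..<?n. if (vs ! i, vs ! j) \<in> parcs G then x (vs ! j) else 0)"
      using i y by (auto simp: adj_matrix_wrt_def scalar_prod_def xy intro!: sum.cong)
    then show ?thesis
      using sum.reindex_bij_betw[OF bij, of "\<lambda>w. if (vs ! i, w) \<in> parcs G then x w else 0"]
      by simp
  qed
  have dim: "dim_row (adj_matrix_wrt G vs) = ?n" by (simp add: adj_matrix_wrt_def)
  show ?thesis
  proof
    assume "eigenvalue (adj_matrix_wrt G vs) k"
    then obtain y where y: "y \<in> carrier_vec ?n" "y \<noteq> 0\<^sub>v ?n" "adj_matrix_wrt G vs *\<^sub>v y = k \<cdot>\<^sub>v y"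
      unfolding eigenvalue_def eigenvector_def dim by blast
    define x where "x = (\<lambda>v. y $ the_inv_into {0..<?n} ((!) vs) v)"
    have xy: "x (vs ! j) = y $ j" if "j < ?n" for j
      using the_inv_into_f_f[OF bij_betw_imp_inj_on[OF bij], of j] that by (simp add: x_def)
    from y(1,2) obtain j where j: "j < ?n" "y $ j \<noteq> 0"
      by (metis carrier_vecD eq_vecI index_zero_vec)
    have "\<exists>v\<in>pverts G. x v \<noteq> 0" using j xy assms(2) nth_mem by metis
    moreover have "(\<Sum>w\<in>pverts G. if (v, w) \<in> parcs G then x w else 0) = k * x v"
      if v: "v \<in> pverts G" for v
    proof -
      obtain i where i: "i < ?n" "v = vs ! i" using v assms(2) by (metis in_set_conv_nth)
      show ?thesis using mult[OF i(1) y(1) xy] y(1) xy[OF i(1)] i unfolding y(3) by simp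
    qed
    ultimately show "\<exists>x. (\<exists>v\<in>pverts G. x v \<noteq> 0) \<and>
         (\<forall>v\<in>pverts G. (\<Sum>w\<in>pverts G. if (v, w) \<in> parcs G then x w else 0) = k * x v)"
      by blast
  next
    assume "\<exists>x. (\<exists>v\<in>pverts G. x v \<noteq> 0) \<and>
         (\<forall>v\<in>pverts G. (\<Sum>w\<in>pverts G. if (v, w) \<in> parcs G then x w else 0) = k * x v)"
    then obtain x where x0: "\<exists>v\<in>pverts G. x v \<noteq> 0"
      and x: "\<And>v. v \<in> pverts G \<Longrightarrow>
        (\<Sum>w\<in>pverts G. if (v, w) \<in> parcs G then x w else 0) = k * x v" by blast
    define y where "y = vec ?n (\<lambda>i. x (vs ! i))"
    have yc: "y \<in> carrier_vec ?n" by (simp add: y_def)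
    obtain j where j: "j < ?n" "x (vs ! j) \<noteq> 0" using x0 assms(2) by (metis in_set_conv_nth)
    have "y \<noteq> 0\<^sub>v ?n" using j by (auto simp: y_def dest: arg_cong[of _ _ "\<lambda>z. z $ j"])
    moreover have "adj_matrix_wrt G vs *\<^sub>v y = k \<cdot>\<^sub>v y"
    proof (rule eq_vecI)
      fix i assume "i < dim_vec (k \<cdot>\<^sub>v y)"
      then have i: "i < ?n" using yc by simp
      have "vs ! i \<in> pverts G" using i assms(2) nth_mem by blast
      then show "(adj_matrix_wrt G vs *\<^sub>v y) $ i = (k \<cdot>\<^sub>v y) $ i"
        using mult[OF i yc, of x] x i by (simp add: y_def)
    qed (simp add: y_def dim)
    ultimately show "eigenvalue (adj_matrix_wrt G vs) k"
      unfolding eigenvalue_def eigenvector_def dim using yc by blast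
  qed
qed

lemma spectrum_adj_matrix:
  assumes "pair_graph G" "distinct vs" "set vs = pverts G"
  shows "spectrum (adj_matrix G) = spectrum (adj_matrix_wrt G vs)"
  unfolding spectrum_def adj_matrix_def
  by (intro Collect_cong)
    (simp only: eigenvalue_adj_matrix_wrt[OF vertex_list[OF assms(1)]]
      eigenvalue_adj_matrix_wrt[OF assms(2,3)])

lemma graph_iso_iff:
  assumes "pair_graph G" "pair_graph H"
  shows "G \<cong>\<^sub>g H \<longleftrightarrow> (\<exists>f. bij_betw f (pverts G) (pverts H) \<and>
           (\<forall>u\<in>pverts G. \<forall>v\<in>pverts G. (u, v) \<in> parcs G \<longleftrightarrow> (f u, f v) \<in> parcs H))"
    (is "_ \<longleftrightarrow> (\<exists>f. ?iso f)")
proof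
  assume "G \<cong>\<^sub>g H"
  then obtain h where inj: "inj_on (iso_verts h) (pverts G)"
    and arc: "\<And>a. a \<in> parcs G \<Longrightarrow> iso_verts h (fst a) = iso_tail h (iso_arcs h a) \<and>
                iso_verts h (snd a) = iso_head h (iso_arcs h a)"
    and H: "with_proj H = app_iso h (with_proj G)"
    unfolding digraph_iso_def pre_digraph.digraph_isomorphism_def by auto
  have verts: "pverts H = iso_verts h ` pverts G" and arcs: "parcs H = iso_arcs h ` parcs G"
    and ends: "iso_tail h = fst" "iso_head h = snd"
    using H by (simp_all add: with_proj_def app_iso_def)
  have ia: "iso_arcs h (u, v) = (iso_verts h u, iso_verts h v)" if "(u, v) \<in> parcs G" for u v
    using arc[OF that] ends by (simp add: prod_eq_iff)
  have "?iso (iso_verts h)"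
  proof (intro conjI ballI iffI)
    show "bij_betw (iso_verts h) (pverts G) (pverts H)"
      using inj verts by (simp add: bij_betw_def)
  next
    fix u v assume "(u, v) \<in> parcs G"
    then show "(iso_verts h u, iso_verts h v) \<in> parcs H"
      using ia arcs by (metis imageI)
  next
    fix u v assume uv: "u \<in> pverts G" "v \<in> pverts G" "(iso_verts h u, iso_verts h v) \<in> parcs H"
    then obtain a b where ab: "(a, b) \<in> parcs G"
      "(iso_verts h u, iso_verts h v) = iso_arcs h (a, b)" using arcs by auto
    moreover have "a \<in> pverts G" "b \<in> pverts G" using pair_graphD(2)[OF assms(1)] ab(1) by auto
    ultimately show "(u, v) \<in> parcs G" using ia inj uv(1,2) by (metis Pair_inject inj_onD)
  qed
  then show "\<exists>f. ?iso f" by blast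
next
  assume "\<exists>f. ?iso f"
  then obtain f where bij: "bij_betw f (pverts G) (pverts H)"
    and adj: "\<And>u v. u \<in> pverts G \<Longrightarrow> v \<in> pverts G \<Longrightarrow>
                (u, v) \<in> parcs G \<longleftrightarrow> (f u, f v) \<in> parcs H" by blast
  note G = pair_graphD(2)[OF assms(1)] and H = pair_graphD(2)[OF assms(2)]
  have inj: "inj_on f (pverts G)" and img: "f ` pverts G = pverts H"
    using bij by (simp_all add: bij_betw_def)
  interpret G: pair_graph G by fact
  define h where "h = \<lparr> iso_verts = f, iso_arcs = map_prod f f, iso_head = snd, iso_tail = fst \<rparr>"
  have "inj_on (map_prod f f) (parcs G)"
    using map_prod_inj_on[OF inj inj] G by (rule inj_on_subset)
  then have "pre_digraph.digraph_isomorphism (with_proj G) h"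
    unfolding pre_digraph.digraph_isomorphism_def h_def
    using inj G.wf_digraph_axioms by auto
  moreover have "map_prod f f ` parcs G = parcs H"
  proof (intro equalityI subsetI)
    fix e assume "e \<in> map_prod f f ` parcs G"
    then obtain u v where "(u, v) \<in> parcs G" "e = (f u, f v)" by auto
    then show "e \<in> parcs H" using adj[of u v] G by auto
  next
    fix e assume e: "e \<in> parcs H"
    obtain x y where xy: "e = (x, y)" by force
    have "x \<in> f ` pverts G" "y \<in> f ` pverts G" using e xy H img by auto
    then obtain u v where uv: "u \<in> pverts G" "v \<in> pverts G" "x = f u" "y = f v" by blast
    then have "(u, v) \<in> parcs G" using adj e xy by simp
    then show "e \<in> map_prod f f ` parcs G"
      unfolding xy uv(3,4) by (metis (no_types) imageI map_prod_simp)
  qed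
  then have "with_proj H = app_iso h (with_proj G)"
    using img by (simp add: with_proj_def app_iso_def h_def)
  ultimately show "G \<cong>\<^sub>g H" unfolding digraph_iso_def by blast
qed

end

theory Submission
  imports Defs "HOL-Analysis.Function_Topology" "HOL-Analysis.Convex"
begin

text \<open>
  Let \<open>G\<close> be a graph of large order \<open>n\<close> without the forbidden minor whose spectral radius
  \<open>r\<close> is at least that of the extremal graph, so that \<open>r\<^sup>2\<close> is at least
  \<open>t * (n - t)\<close>.  It is shown that \<open>G\<close> is the extremal graph; as isomorphic graphs have the same
  spectral radius, both claims of the theorem follow.

  The minor enters through flowers, that is, \<open>t\<close> cycles of length at least four that share one vertex
  and are otherwise disjoint (\<open>flower_imp_Q_minor\<close>).  Their absence has three consequences: edges are
  sparse in every vertex set, because a longest path in a set of large minimum degree folds into a flower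
  (\<open>arcs_within_bound\<close>); no \<open>t + 1\<close> vertices have \<open>2 * t\<close> common neighbours
  (\<open>common_nbrs_imp_flower\<close>); and if \<open>t\<close> vertices, the hub, have many common neighbours, then
  outside the hub no path with at least three vertices joins two neighbours of the same hub vertex
  (\<open>ear_avoiding_hub_imp_flower\<close>).

  Let \<open>x\<close> be a nonnegative eigenfunction for \<open>r\<close> with maximum one.  Expanding
  \<open>r\<^sup>2 * x v\<close> over walks of length two and using the first two consequences, one finds \<open>t\<close>
  vertices whose entries are close to one and which are adjacent to almost all vertices
  (\<open>exists_hub\<close>).  This is the hub \<open>T\<close>.

  By the third consequence each component outside \<open>T\<close> contains at most two neighbours of each hub
  vertex.  It is therefore small and receives little weight from the hub, so the sum of \<open>x\<close> over it is at
  most \<open>1 / 8\<close> (\<open>component_mass\<close>).  Moreover the edges among the common neighbours of \<open>T\<close>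
  form a matching, so the extremal graph \<open>H\<close> can be laid over \<open>G\<close> with \<open>T\<close> as its clique and
  with these edges among its edges (\<open>extremal_embedding\<close>).

  Finally the quadratic forms of \<open>G\<close> and \<open>H\<close> are compared at \<open>x\<close>.  Every vertex that is not
  adjacent to all of \<open>T\<close> gains a heavy edge to \<open>T\<close> and loses edges of small total weight
  (\<open>compare_forms\<close>).  So the form of \<open>H\<close> is at least that of \<open>G\<close>, the Rayleigh principle
  gives equality of the spectral radii, and the discussion of equality forces \<open>G = H\<close>
  (\<open>graph_eq_if_spectral_radius_ge\<close>).
\<close>

section \<open>Flowers\<close>

definition nbrs :: "'a pair_pre_digraph \<Rightarrow> 'a \<Rightarrow> 'a set" where
  "nbrs G v = {u. (v, u) \<in> parcs G}"

definition is_path :: "'a pair_pre_digraph \<Rightarrow> 'a list \<Rightarrow> bool" where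
  "is_path G p \<longleftrightarrow> distinct p \<and> set p \<subseteq> pverts G \<and> successively (\<lambda>u v. (u, v) \<in> parcs G) p"

text \<open>
  A cycle through \<open>v\<close> of length at least four is recorded as the path that remains of it
  after \<open>v\<close> is removed.  Three vertices are the minimum because the cycle has to contract onto a
  4-cycle.
\<close>

definition ear :: "'a pair_pre_digraph \<Rightarrow> 'a \<Rightarrow> 'a list \<Rightarrow> bool" where
  "ear G v p \<longleftrightarrow> is_path G p \<and> 3 \<le> length p \<and> hd p \<in> nbrs G v \<and> last p \<in> nbrs G v"

text \<open>
  A subdivision of the target graph: disjoint ears at \<open>v\<close>, whose number is the number of 4-cycles.
  All minors found below arise in this topological form.
\<close>

definition flower :: "'a pair_pre_digraph \<Rightarrow> 'a \<Rightarrow> 'a list list \<Rightarrow> bool" where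
  "flower G v ps \<longleftrightarrow> distinct (v # concat ps) \<and> (\<forall>p\<in>set ps. ear G v p)"

section \<open>A flower yields a minor\<close>

text \<open>
  Superfluous vertices are deleted before edges: deleting a vertex outside \<open>H\<close> loses no arc of \<open>H\<close>.
\<close>

lemma subgraph_minor_steps:
  assumes "pair_graph G" "pair_graph H" "pverts H \<subseteq> pverts G" "parcs H \<subseteq> parcs G"
  shows "minor_step\<^sup>*\<^sup>* G H"
  using assms
proof (induction "card (pverts G) + card (parcs G)" arbitrary: G rule: less_induct)
  case less
  have fV: "finite (pverts G)" using pair_graphD(1)[OF less.prems(1)] .
  then have fE: "finite (parcs G)"
    using pair_graphD(2)[OF less.prems(1)] by (meson finite_SigmaI finite_subset)
  consider (v) v where "v \<in> pverts G" "v \<notin> pverts H"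
    | (e) u v where "pverts G = pverts H" "(u, v) \<in> parcs G" "(u, v) \<notin> parcs H"
    | (eq) "pverts G = pverts H" "parcs G = parcs H"
    using less.prems(3,4) by (metis subrelI subsetI subset_antisym)
  then show ?case
  proof cases
    case v
    let ?G = "delete_vertex v G"
    have st: "minor_step G ?G" using v(1) by (rule minor_step.delete_vertex)
    have "card (pverts ?G) < card (pverts G)"
      using card_Diff1_less[OF fV v(1)] by (simp add: delete_vertex_def)
    moreover have "card (parcs ?G) \<le> card (parcs G)"
      using fE by (auto simp: delete_vertex_def intro!: card_mono)
    moreover have "pverts H \<subseteq> pverts ?G" "parcs H \<subseteq> parcs ?G"
      using less.prems(3,4) v(2) pair_graphD(2)[OF less.prems(2)] by (auto simp: delete_vertex_def)
    ultimately have "minor_step\<^sup>*\<^sup>* ?G H"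
      using less.hyps[of ?G] pair_graph_minor_step[OF st less.prems(1)] less.prems(2) by simp
    with st show ?thesis by (rule converse_rtranclp_into_rtranclp)
  next
    case e
    let ?G = "delete_edge u v G"
    have st: "minor_step G ?G" using e(2) by (rule minor_step.delete_edge)
    have "(v, u) \<notin> parcs H" using e(3) pair_graphD(3)[OF less.prems(2)] by blast
    then have "pverts H \<subseteq> pverts ?G" "parcs H \<subseteq> parcs ?G"
      using less.prems(3,4) e by (auto simp: delete_edge_def)
    moreover have "card (parcs ?G) < card (parcs G)"
      using e(2) fE by (auto simp: delete_edge_def intro!: psubset_card_mono)
    moreover have "pverts ?G = pverts G" by (simp add: delete_edge_def)
    ultimately have "minor_step\<^sup>*\<^sup>* ?G H"
      using less.hyps[of ?G] pair_graph_minor_step[OF st less.prems(1)] less.prems(2) by simp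
    with st show ?thesis by (rule converse_rtranclp_into_rtranclp)
  next
    case eq
    then have "G = H" by simp
    then show ?thesis by simp
  qed
qed

lemma is_minor_step:
  assumes "minor_step G G'" "is_minor H G'"
  shows "is_minor H G"
  using assms unfolding is_minor_def by (meson converse_rtranclp_into_rtranclp)

text \<open>
  The copy of \<open>H\<close> inside \<open>G\<close> is cut out by deletions alone.
\<close>

lemma embedding_imp_minor:
  assumes G: "pair_graph G" and H: "pair_graph H"
    and inj: "inj_on f (pverts H)" and V: "f ` pverts H \<subseteq> pverts G"
    and E: "\<And>u v. (u, v) \<in> parcs H \<Longrightarrow> (f u, f v) \<in> parcs G"
  shows "is_minor H G"
proof -
  define H' where "H' = \<lparr> pverts = f ` pverts H, parcs = {(f u, f v) | u v. (u, v) \<in> parcs H} \<rparr>"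
  note PH = pair_graphD[OF H] and PG = pair_graphD[OF G]
  have H': "pair_graph H'"
  proof (rule pair_graphI)
    show "finite (pverts H')" using PH(1) by (simp add: H'_def)
    show "parcs H' \<subseteq> pverts H' \<times> pverts H'" using PH(2) by (auto simp: H'_def)
    show "(v, u) \<in> parcs H'" if "(u, v) \<in> parcs H'" for u v
      using that PH(3) by (auto simp: H'_def)
    show "(u, u) \<notin> parcs H'" for u
      using E PG(4) by (fastforce simp: H'_def)
  qed
  have "minor_step\<^sup>*\<^sup>* G H'"
    using V E by (intro subgraph_minor_steps[OF G H']) (auto simp: H'_def)
  moreover have "H \<cong>\<^sub>g H'"
    unfolding graph_iso_iff[OF H H']
  proof (intro exI[of _ f] conjI ballI)
    show "bij_betw f (pverts H) (pverts H')" using inj by (simp add: bij_betw_def H'_def)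
    fix u v assume uv: "u \<in> pverts H" "v \<in> pverts H"
    show "(u, v) \<in> parcs H \<longleftrightarrow> (f u, f v) \<in> parcs H'"
    proof
      assume "(f u, f v) \<in> parcs H'"
      then obtain a b where ab: "(a, b) \<in> parcs H" "f u = f a" "f v = f b" by (auto simp: H'_def)
      then have "a \<in> pverts H" "b \<in> pverts H" using PH(2) by auto
      then show "(u, v) \<in> parcs H" using ab uv inj by (metis inj_onD)
    qed (auto simp: H'_def)
  qed
  ultimately show ?thesis unfolding is_minor_def by blast
qed

lemma nth_in_concat:
  assumes "i < length ps" "j < length (ps ! i)"
  shows "ps ! i ! j \<in> set (concat ps)"
  using assms by (auto intro!: bexI[of _ "ps ! i"])

lemma distinct_concat_nth_eq:
  assumes "distinct (concat ps)" "i < length ps" "i' < length ps" "j < length (ps ! i)"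
    "j' < length (ps ! i')" "ps ! i ! j = ps ! i' ! j'"
  shows "i = i' \<and> j = j'"
  using assms
proof (induction ps arbitrary: i i')
  case (Cons p ps)
  show ?case
  proof (cases i; cases i')
    assume "i = 0" "i' = 0"
    then show ?thesis using Cons.prems by (auto simp: nth_eq_iff_index_eq)
  next
    fix k assume "i = 0" "i' = Suc k"
    then show ?thesis using Cons.prems nth_in_concat[of k ps j'] nth_mem[of j p]
      by (auto simp: disjoint_iff simp del: set_concat nth_mem)
  next
    fix k assume "i = Suc k" "i' = 0"
    then show ?thesis using Cons.prems nth_in_concat[of k ps j] nth_mem[of j' p]
      by (auto simp: disjoint_iff simp del: set_concat nth_mem)
  next
    fix k k' assume "i = Suc k" "i' = Suc k'"
    then show ?thesis using Cons.IH[of k k'] Cons.prems by auto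
  qed
qed simp

text \<open>
  When every ear has exactly three vertices the flower contains the target graph as a subgraph:
  vertex \<open>3i+j+1\<close> is mapped to the \<open>j\<close>-th vertex of the \<open>i\<close>-th ear.
\<close>

lemma short_flower_imp_Q_minor:
  assumes G: "pair_graph G" and fl: "flower G v ps" and short: "\<And>p. p \<in> set ps \<Longrightarrow> length p = 3"
    and ne: "ps \<noteq> []"
  shows "is_minor (Q_graph (length ps)) G"
proof -
  define f where "f k = (if k = 0 then v else ps ! ((k - 1) div 3) ! ((k - 1) mod 3))" for k :: nat
  have dist: "distinct (concat ps)" "v \<notin> set (concat ps)"
    and ear: "\<And>p. p \<in> set ps \<Longrightarrow> ear G v p"
    using fl by (auto simp: flower_def)
  have len: "length (ps ! i) = 3" if "i < length ps" for i using that short by simp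
  have f0: "f 0 = v" by (simp add: f_def)
  have f1: "f (3*i+1) = ps ! i ! 0" "f (3*i+2) = ps ! i ! 1" "f (3*i+3) = ps ! i ! 2" for i
  proof -
    have "(3*i+2 - 1) div 3 = i" "(3*i+2 - 1) mod 3 = 1" "(3*i+3 - 1) div 3 = i" "(3*i+3 - 1) mod 3 = 2"
      by (simp_all add: div_Suc mod_Suc)
    then show "f (3*i+1) = ps ! i ! 0" "f (3*i+2) = ps ! i ! 1" "f (3*i+3) = ps ! i ! 2"
      unfolding f_def by simp_all
  qed
  have edges: "(v, ps!i!0) \<in> parcs G" "(ps!i!0, ps!i!1) \<in> parcs G" "(ps!i!1, ps!i!2) \<in> parcs G"
      "(v, ps!i!2) \<in> parcs G" "ps!i!0 \<in> pverts G" "ps!i!1 \<in> pverts G" "ps!i!2 \<in> pverts G"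
    if i: "i < length ps" for i
  proof -
    obtain a b c where p: "ps ! i = [a, b, c]"
      using len[OF i] by (auto simp: length_Suc_conv numeral_3_eq_3)
    have "ear G v (ps ! i)" using ear i by simp
    then show "(v, ps!i!0) \<in> parcs G" "(ps!i!0, ps!i!1) \<in> parcs G" "(ps!i!1, ps!i!2) \<in> parcs G"
      "(v, ps!i!2) \<in> parcs G" "ps!i!0 \<in> pverts G" "ps!i!1 \<in> pverts G" "ps!i!2 \<in> pverts G"
      unfolding p ear_def is_path_def nbrs_def by simp_all
  qed
  have vG: "v \<in> pverts G" using edges(1)[of 0] ne pair_graphD(2)[OF G] by auto
  show ?thesis
  proof (rule embedding_imp_minor[OF G pair_graph_Q, of f])
    have idx: "(k - 1) div 3 < length ps" "(k - 1) mod 3 < 3"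
      if "k \<in> {0..3 * length ps}" "k \<noteq> 0" for k :: nat
      using that by auto
    show "inj_on f (pverts (Q_graph (length ps)))"
    proof (rule inj_onI)
      fix k l assume "k \<in> pverts (Q_graph (length ps))" "l \<in> pverts (Q_graph (length ps))" and eq: "f k = f l"
      then have kl: "k \<in> {0..3 * length ps}" "l \<in> {0..3 * length ps}"
        by (auto simp: Q_graph_def Let_def)
      have nz: "f m \<in> set (concat ps)" if "m \<in> {0..3 * length ps}" "m \<noteq> 0" for m
        using nth_in_concat[of "(m - 1) div 3" ps "(m - 1) mod 3"] idx[OF that] len that
        by (simp add: f_def)
      show "k = l"
      proof (cases "k = 0 \<or> l = 0")
        case True
        then show ?thesis using eq nz kl dist(2) f0 by metis
      next
        case False
        then have "(k - 1) div 3 = (l - 1) div 3 \<and> (k - 1) mod 3 = (l - 1) mod 3"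
          using eq idx[OF kl(1)] idx[OF kl(2)] len
          by (intro distinct_concat_nth_eq[OF dist(1)]) (auto simp: f_def)
        then have "k - 1 = l - 1" by (metis div_mod_decomp)
        then show ?thesis using False by arith
      qed
    qed
    have "f k \<in> pverts G" if "k \<in> {0..3 * length ps}" for k
    proof (cases "k = 0")
      case False
      have "(k - 1) mod 3 = 0 \<or> (k - 1) mod 3 = 1 \<or> (k - 1) mod 3 = 2"
        using idx(2)[OF that False] by linarith
      then show ?thesis using edges(5,6,7)[OF idx(1)[OF that False]] False
        unfolding f_def by (elim disjE) (simp_all only: if_False)
    qed (simp add: f_def vG)
    then show "f ` pverts (Q_graph (length ps)) \<subseteq> pverts G"
      by (auto simp: Q_graph_def Let_def)
    fix a b assume "(a, b) \<in> parcs (Q_graph (length ps))"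
    then obtain i where i: "i < length ps"
      and ab: "(a, b) \<in> {(0, 3*i + 1), (3*i + 1, 3*i + 2), (3*i + 2, 3*i + 3), (3*i + 3, 0)} \<or>
            (b, a) \<in> {(0, 3*i + 1), (3*i + 1, 3*i + 2), (3*i + 2, 3*i + 3), (3*i + 3, 0)}"
      by (auto simp: Q_graph_def Let_def)
    show "(f a, f b) \<in> parcs G"
      using ab edges[OF i] pair_graphD(3)[OF G] 
      by (auto simp add: f0 f1 simp del: One_nat_def add_2_eq_Suc' add_Suc_right mult_Suc_right)
  qed
qed

lemma contract_arcI:
  assumes "(x, y) \<in> parcs G" "(id(v := u)) x \<noteq> (id(v := u)) y"
  shows "((id(v := u)) x, (id(v := u)) y) \<in> parcs (contract_edge u v G)"
  unfolding contract_edge_def Let_def using assms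
  by (simp only: pair_pre_digraph.simps mem_Collect_eq) blast

text \<open>
  Shortening an ear by one vertex.  The contraction keeps the first vertex \<open>a\<close>, so the arc from
  the centre survives, and \<open>a\<close> inherits the arc from \<open>b\<close> to the rest of the ear.
\<close>

lemma contract_flower:
  assumes G: "pair_graph G" and fl: "flower G v (ps1 @ (a # b # q) # ps2)" and len: "2 \<le> length q"
  shows "flower (contract_edge a b G) v (ps1 @ (a # q) # ps2)"
proof -
  let ?G = "contract_edge a b G"
  have d: "distinct (v # concat (ps1 @ (a # b # q) # ps2))" using fl by (simp add: flower_def)
  have keep: "(x, y) \<in> parcs ?G" if "(x, y) \<in> parcs G" "x \<noteq> b" "y \<noteq> b" for x y
  proof -
    have "x \<noteq> y" using that(1) pair_graphD(4)[OF G] by blast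
    then show ?thesis
      using that contract_arcI[of x y G b a] by simp
  qed
  have succ: "successively (\<lambda>u v. (u, v) \<in> parcs ?G) p"
    if "successively (\<lambda>u v. (u, v) \<in> parcs G) p" "b \<notin> set p" for p
    using that(1) by (rule successively_mono) (use that(2) in \<open>auto intro: keep\<close>)
  have V: "pverts ?G = pverts G - {b}" by (simp add: contract_edge_def Let_def)
  have ear: "ear ?G v p" if p: "ear G v p" "b \<notin> set p" for p
  proof -
    have "p \<noteq> []" using p(1) by (auto simp: ear_def)
    then have "hd p \<noteq> b" "last p \<noteq> b" "v \<noteq> b" using p(2) d by auto
    moreover have "successively (\<lambda>u v. (u, v) \<in> parcs ?G) p"
      using p by (intro succ) (auto simp: ear_def is_path_def)
    ultimately show ?thesis
      using p keep[of v "hd p"] keep[of v "last p"] by (auto simp: ear_def is_path_def nbrs_def V)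
  qed
  have e: "ear G v (a # b # q)" using fl by (simp add: flower_def)
  obtain c q' where q: "q = c # q'" using len by (cases q) auto
  have "ear ?G v (a # q)"
  proof -
    have bc: "(b, c) \<in> parcs G" using e by (auto simp: ear_def is_path_def q)
    have "(a, c) \<in> parcs ?G"
    proof -
      have "c \<noteq> b" "a \<noteq> c" using d by (auto simp: q)
      then show ?thesis
        using bc contract_arcI[of b c G b a] by simp
    qed
    moreover have "successively (\<lambda>u v. (u, v) \<in> parcs ?G) q"
      using e d by (intro succ) (auto simp: ear_def is_path_def q)
    moreover have "last q \<noteq> b" "v \<noteq> b" "a \<noteq> b" using d q last_in_set[of q] by auto
    then have "a \<in> nbrs ?G v" "last q \<in> nbrs ?G v"
      using e keep[of v a] keep[of v "last q"] q by (auto simp: ear_def nbrs_def)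
    ultimately show ?thesis using e d len
      by (auto simp: ear_def is_path_def q V)
  qed
  moreover have "ear ?G v p" if "p \<in> set ps1 \<union> set ps2" for p
  proof (rule ear)
    show "ear G v p" using fl that by (auto simp: flower_def)
    show "b \<notin> set p" using d that by auto
  qed
  ultimately show ?thesis using d by (auto simp: flower_def)
qed

text \<open>
  Long ears are contracted one edge at a time until all of them have three vertices.
\<close>

lemma flower_imp_Q_minor:
  assumes "pair_graph G" "flower G v ps" "ps \<noteq> []"
  shows "is_minor (Q_graph (length ps)) G"
  using assms
proof (induction "length (concat ps)" arbitrary: G ps rule: less_induct)
  case less
  show ?case
  proof (cases "\<forall>p\<in>set ps. length p = 3")
    case True
    then show ?thesis using less.prems by (intro short_flower_imp_Q_minor) auto
  next
    case False
    then obtain p where p: "p \<in> set ps" "length p \<noteq> 3" by blast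
    have e: "ear G v p" using less.prems p by (simp add: flower_def)
    then obtain a b q where q: "p = a # b # q" "2 \<le> length q"
      using p(2) by (cases p rule: remdups_adj.cases) (auto simp: ear_def)
    obtain ps1 ps2 where ps: "ps = ps1 @ (a # b # q) # ps2" using split_list[OF p(1)] q(1) by blast
    have st: "minor_step G (contract_edge a b G)"
      using e by (intro minor_step.contract_edge) (simp add: ear_def is_path_def q)
    have "is_minor (Q_graph (length (ps1 @ (a # q) # ps2))) (contract_edge a b G)"
    proof (rule less.hyps)
      show "pair_graph (contract_edge a b G)" using pair_graph_minor_step[OF st less.prems(1)] .
      show "flower (contract_edge a b G) v (ps1 @ (a # q) # ps2)"
        using contract_flower[OF less.prems(1) _ q(2)] less.prems(2) ps by blast
    qed (simp_all add: ps)
    then show ?thesis using is_minor_step[OF st] ps by simp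
  qed
qed

section \<open>Edge density without flowers\<close>

lemma finite_nbrs:
  assumes "pair_graph G"
  shows "finite (nbrs G v)" "nbrs G v \<subseteq> pverts G"
proof -
  show "nbrs G v \<subseteq> pverts G" using pair_graphD(2)[OF assms] by (auto simp: nbrs_def)
  then show "finite (nbrs G v)" using pair_graphD(1)[OF assms] finite_subset by blast
qed

lemma nbrs_sym: "pair_graph G \<Longrightarrow> u \<in> nbrs G v \<longleftrightarrow> v \<in> nbrs G u"
  using pair_graphD(3) by (auto simp: nbrs_def)

lemma not_self_nbr: "pair_graph G \<Longrightarrow> v \<notin> nbrs G v"
  using pair_graphD(4)[of G v] by (simp add: nbrs_def)

lemma is_path_append:
  "is_path G (p @ q) \<Longrightarrow> is_path G p \<and> is_path G q"
  by (auto simp: is_path_def successively_append_iff)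

lemma split_first_hit:
  assumes "Suc k \<le> card (set q \<inter> N)"
  shows "\<exists>q1 a q2. q = q1 @ a # q2 \<and> a \<in> N \<and> k \<le> card (set q2 \<inter> N)"
proof -
  have "set q \<inter> N \<noteq> {}" using assms by auto
  then obtain q1 a q2 where q: "q = q1 @ a # q2" "a \<in> N" "\<forall>y\<in>set q1. y \<notin> N"
    using split_list_first_prop[of q "\<lambda>x. x \<in> N"] by blast
  then have "set q \<inter> N = insert a (set q2 \<inter> N)" by auto
  then have "card (set q \<inter> N) \<le> Suc (card (set q2 \<inter> N))"
    using card_insert_le_m1 by (simp add: card_insert_if)
  then show ?thesis using q assms by (intro exI[of _ q1] exI[of _ a] exI[of _ q2]) auto
qed

text \<open>
  If \<open>v\<close> has many neighbours on a path, then every three consecutive ones bound a segment of the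
  path that is an ear at \<open>v\<close>.
\<close>

lemma cut_path_into_ears:
  assumes "is_path G q" "3 * t \<le> card (set q \<inter> nbrs G v)"
  shows "\<exists>ps. length ps = t \<and> (\<forall>p\<in>set ps. ear G v p) \<and> distinct (concat ps)
           \<and> set (concat ps) \<subseteq> set q"
  using assms
proof (induction t arbitrary: q)
  case (Suc t)
  have "Suc (Suc (Suc (3 * t))) \<le> card (set q \<inter> nbrs G v)" using Suc.prems(2) by simp
  then obtain q1 a q2 where q: "q = q1 @ a # q2" and a: "a \<in> nbrs G v"
    and "Suc (Suc (3 * t)) \<le> card (set q2 \<inter> nbrs G v)"
    using split_first_hit by metis
  then obtain q3 b q4 where q2: "q2 = q3 @ b # q4" "Suc (3 * t) \<le> card (set q4 \<inter> nbrs G v)"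
    using split_first_hit by metis
  then obtain q5 c q6 where q4: "q4 = q5 @ c # q6" and c: "c \<in> nbrs G v"
    and q6: "3 * t \<le> card (set q6 \<inter> nbrs G v)"
    using split_first_hit by metis
  let ?p = "a # q3 @ b # q5 @ [c]"
  have q': "q = q1 @ ?p @ q6" using q q2 q4 by simp
  have "is_path G ?p" "is_path G q6"
    using Suc.prems(1) unfolding q' by (blast dest: is_path_append)+
  then obtain ps where ps: "length ps = t" "\<forall>p\<in>set ps. ear G v p" "distinct (concat ps)"
    "set (concat ps) \<subseteq> set q6" using Suc.IH q6 by blast
  have "ear G v ?p" using \<open>is_path G ?p\<close> a c by (simp add: ear_def)
  moreover have "distinct (?p @ concat ps)"
    using Suc.prems(1) ps(3,4) unfolding q' is_path_def by auto
  ultimately show ?case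
    using ps q' by (intro exI[of _ "?p # ps"]) auto
qed simp

text \<open>
  All neighbours within \<open>S\<close> of the first vertex of a longest path in \<open>S\<close> lie on that path,
  which can therefore be cut into ears.
\<close>

lemma min_degree_imp_flower:
  assumes G: "pair_graph G" and S: "S \<subseteq> pverts G" "S \<noteq> {}"
    and deg: "\<And>v. v \<in> S \<Longrightarrow> 3 * t \<le> card (nbrs G v \<inter> S)"
  shows "\<exists>v ps. flower G v ps \<and> length ps = t"
proof -
  have fS: "finite S" using S pair_graphD(1)[OF G] finite_subset by blast
  obtain s where "s \<in> S" using S by blast
  then have s: "is_path G [s] \<and> set [s] \<subseteq> S" using S by (auto simp: is_path_def)
  have bound: "length p < Suc (card S)" if "is_path G p \<and> set p \<subseteq> S" for p
    using that card_mono[OF fS, of "set p"] by (auto simp: is_path_def distinct_card)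
  obtain p where p: "is_path G p" "set p \<subseteq> S"
    and max: "\<And>q. is_path G q \<and> set q \<subseteq> S \<Longrightarrow> length q \<le> length p"
    using ex_has_greatest_nat[of "\<lambda>p. is_path G p \<and> set p \<subseteq> S" "[s]" length "Suc (card S)"]
      s bound by blast
  have "p \<noteq> []" using max[OF s] by auto
  then obtain v q where q: "p = v # q" by (cases p) auto
  have "nbrs G v \<inter> S \<subseteq> set q"
  proof
    fix u assume u: "u \<in> nbrs G v \<inter> S"
    show "u \<in> set q"
    proof (rule ccontr)
      assume "u \<notin> set q"
      moreover have "u \<noteq> v" using u not_self_nbr[OF G] by auto
      moreover have "(u, v) \<in> parcs G" using u pair_graphD(3)[OF G] by (auto simp: nbrs_def)
      ultimately have "is_path G (u # p) \<and> set (u # p) \<subseteq> S"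
        using u p q S by (auto simp: is_path_def)
      then show False using max by fastforce
    qed
  qed
  then have "nbrs G v \<inter> S \<subseteq> set q \<inter> nbrs G v" by blast
  then have "3 * t \<le> card (set q \<inter> nbrs G v)"
    using deg[of v] p(2) q card_mono[of "set q \<inter> nbrs G v" "nbrs G v \<inter> S"] by auto
  moreover have "is_path G q" using p(1) q is_path_append[of G "[v]" q] by simp
  ultimately obtain ps where ps: "length ps = t" "\<forall>p\<in>set ps. ear G v p" "distinct (concat ps)"
    "set (concat ps) \<subseteq> set q" using cut_path_into_ears[of G q t v] by metis
  moreover have "v \<notin> set q" using p(1) q by (simp add: is_path_def)
  ultimately show ?thesis
    by (intro exI[of _ v] exI[of _ ps]) (auto simp: flower_def simp del: set_concat)
qed

text \<open>
  Without a flower every induced subgraph has a vertex of degree below \<open>3t\<close>; such vertices are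
  removed one after the other.  Every edge counts as two arcs.
\<close>

lemma arcs_within_bound:
  assumes G: "pair_graph G" and nofl: "\<And>v ps. flower G v ps \<Longrightarrow> length ps \<noteq> t"
    and S: "S \<subseteq> pverts G"
  shows "card (parcs G \<inter> S \<times> S) \<le> 6 * t * card S"
  using S
proof (induction "card S" arbitrary: S)
  case 0
  then have "S = {}" using finite_subset[OF 0(2) pair_graphD(1)[OF G]] by simp
  then show ?case by simp
next
  case (Suc k)
  have fS: "finite S" using Suc.prems pair_graphD(1)[OF G] finite_subset by blast
  have "S \<noteq> {}" using Suc.hyps(2) by auto
  then obtain v where v: "v \<in> S" "card (nbrs G v \<inter> S) < 3 * t"
    using min_degree_imp_flower[OF G Suc.prems, of t] nofl by (metis not_less)
  let ?N = "nbrs G v \<inter> S" and ?S = "S - {v}"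
  have k: "card ?S = k" using Suc.hyps(2) v(1) fS by simp
  have fN: "finite ?N" using fS by simp
  have "parcs G \<inter> S \<times> S \<subseteq> (parcs G \<inter> ?S \<times> ?S) \<union> ({v} \<times> ?N \<union> ?N \<times> {v})"
    using pair_graphD(3)[OF G] by (auto simp: nbrs_def)
  then have "card (parcs G \<inter> S \<times> S) \<le> card ((parcs G \<inter> ?S \<times> ?S) \<union> ({v} \<times> ?N \<union> ?N \<times> {v}))"
    using fS fN by (intro card_mono) auto
  also have "\<dots> \<le> card (parcs G \<inter> ?S \<times> ?S) + (card ({v} \<times> ?N) + card (?N \<times> {v}))"
    by (meson add_left_mono card_Un_le order_trans)
  also have "\<dots> = card (parcs G \<inter> ?S \<times> ?S) + 2 * card ?N" by (simp add: card_cartesian_product)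
  also have "\<dots> \<le> 6 * t * k + 2 * (3 * t)"
    using Suc.hyps(1)[of ?S] k Suc.prems v(2) by (intro add_mono mult_left_mono) auto
  finally show ?case using Suc.hyps(2) by (simp add: algebra_simps flip: Suc.hyps(2))
qed

section \<open>Hubs and flowers\<close>

text \<open>
  In a complete bipartite graph with the vertices \<open>l\<close> and \<open>ls\<close> on one side, each
  \<open>m\<close> in \<open>ls\<close> gives the 4-cycle \<open>l, a, m, b\<close> with two fresh common neighbours
  \<open>a\<close> and \<open>b\<close>.
\<close>

lemma hub_ears:
  assumes G: "pair_graph G" and "distinct ls" "set ls \<subseteq> pverts G" "finite A" "A \<subseteq> nbrs G l"
    and "\<And>m. m \<in> set ls \<Longrightarrow> A \<subseteq> nbrs G m" and "2 * length ls \<le> card A"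
  shows "\<exists>ps. length ps = length ls \<and> (\<forall>p\<in>set ps. ear G l p) \<and> distinct (concat ps)
           \<and> set (concat ps) \<subseteq> A \<union> set ls"
  using assms(2-)
proof (induction ls arbitrary: A)
  case (Cons m ls)
  have "A \<noteq> {}" using Cons.prems(6) by auto
  then obtain a where a: "a \<in> A" by blast
  have "1 \<le> card (A - {a})" using Cons.prems(6) a Cons.prems(3) by simp
  then have "A - {a} \<noteq> {}" by (metis card.empty not_one_le_zero)
  then obtain b where b: "b \<in> A" "b \<noteq> a" by blast
  let ?A = "A - {a, b}"
  have "card ?A = card A - 2" using a b Cons.prems(3) by (simp add: card_Diff_subset)
  then have "2 * length ls \<le> card ?A" using Cons.prems(6) by simp
  then obtain ps where ps: "length ps = length ls" "\<forall>p\<in>set ps. ear G l p" "distinct (concat ps)"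
    "set (concat ps) \<subseteq> ?A \<union> set ls"
    using Cons.IH[of ?A] Cons.prems by auto
  have am: "a \<in> nbrs G m" "b \<in> nbrs G m" "a \<in> nbrs G l" "b \<in> nbrs G l"
    using a b Cons.prems(4,5) by auto
  then have ab: "(a, m) \<in> parcs G" "(m, b) \<in> parcs G"
    using pair_graphD(3)[OF G] by (auto simp: nbrs_def)
  have A_ls: "A \<inter> set (m # ls) = {}"
    using Cons.prems(5) not_self_nbr[OF G] by blast
  have "ear G l [a, m, b]"
    using am ab a b A_ls pair_graphD(2)[OF G] by (auto simp: ear_def is_path_def)
  moreover have "distinct ([a, m, b] @ concat ps)"
    using ps(3,4) a b A_ls Cons.prems(1) by auto
  ultimately show ?case
    using ps a b by (intro exI[of _ "[a, m, b] # ps"]) auto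
qed auto

lemma common_nbrs_imp_flower:
  assumes G: "pair_graph G" and T: "T \<subseteq> pverts G" "card T = Suc t"
    and A: "\<And>m. m \<in> T \<Longrightarrow> A \<subseteq> nbrs G m" "2 * t \<le> card A" 
  shows "\<exists>v ps. flower G v ps \<and> length ps = t"
proof -
  obtain l where l: "l \<in> T" using T(2) by fastforce
  have fA: "finite A" using A(1)[OF l] finite_nbrs[OF G] finite_subset by blast
  obtain ls where ls: "set ls = T - {l}" "distinct ls"
    using finite_distinct_list[of "T - {l}"] T pair_graphD(1)[OF G] finite_subset by blast
  have len: "length ls = t" using ls l T(2) distinct_card[of ls] by (simp add: card_Diff_singleton_if)
  obtain ps where ps: "length ps = t" "\<forall>p\<in>set ps. ear G l p" "distinct (concat ps)"
    "set (concat ps) \<subseteq> A \<union> (T - {l})"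
    using hub_ears[OF G ls(2) _ fA A(1)[OF l]] ls T A len by auto
  have "l \<notin> A" using A(1)[OF l] not_self_nbr[OF G] by blast
  then have "flower G l ps" using ps by (auto simp: flower_def simp del: set_concat)
  then show ?thesis using ps(1) by blast
qed

text \<open>
  A hub of \<open>t\<close> vertices provides only \<open>t - 1\<close> cycles through one of them, as each cycle uses
  another hub vertex.  An ear outside the hub supplies the missing cycle.  It must not use up the common
  neighbours \<open>A\<close>, so a shortest ear is taken: an inner vertex of it that lies in \<open>A\<close> would cut
  off a shorter ear.
\<close>

lemma ear_avoiding_hub_imp_flower:
  assumes G: "pair_graph G" and T: "T \<subseteq> pverts G" "card T = t" "l \<in> T"
    and A: "\<And>m. m \<in> T \<Longrightarrow> A \<subseteq> nbrs G m" "2 * t + 1 \<le> card A"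
    and ear: "ear G l p0" "set p0 \<inter> T = {}"
  shows "\<exists>v ps. flower G v ps \<and> length ps = t"
proof -
  have fA: "finite A" using A(1)[OF T(3)] finite_nbrs[OF G] finite_subset by blast
  have fT: "finite T" using T(1) pair_graphD(1)[OF G] finite_subset by blast
  obtain p where p: "ear G l p" "set p \<inter> T = {}"
    and min: "\<And>q. ear G l q \<Longrightarrow> set q \<inter> T = {} \<Longrightarrow> length p \<le> length q"
    using ex_has_least_nat[of "\<lambda>p. ear G l p \<and> set p \<inter> T = {}" p0 length] ear by blast
  have "card (set p \<inter> A) \<le> 3"
  proof (cases "length p \<le> 3")
    case True
    have "card (set p \<inter> A) \<le> card (set p)" by (intro card_mono) auto
    then show ?thesis using True card_length[of p] by linarith
  next
    case False
    have "set p \<inter> A \<subseteq> {hd p, last p}"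
    proof
      fix x assume x: "x \<in> set p \<inter> A"
      then obtain p1 p2 where p12: "p = p1 @ x # p2" using split_list[of x p] by blast
      have xl: "x \<in> nbrs G l" using x A(1)[OF T(3)] by blast
      have path: "is_path G p" using p(1) by (simp add: ear_def)
      have path1: "is_path G (p1 @ [x])"
        using path is_path_append[of G "p1 @ [x]" p2] unfolding p12 by simp
      have path2: "is_path G (x # p2)"
        using path is_path_append[of G p1 "x # p2"] unfolding p12 by simp
      have "p1 = [] \<or> p2 = []"
      proof (rule ccontr)
        assume ne: "\<not> (p1 = [] \<or> p2 = [])"
        show False
        proof (cases "2 \<le> length p1")
          \<comment> \<open>A part of \<open>p\<close> that has \<open>x\<close> as an end and is long enough is a shorter ear.\<close>
          case True
          then have "ear G l (p1 @ [x])"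
            using path1 p(1) xl ne unfolding ear_def p12 by (cases p1) auto
          then show False using min[of "p1 @ [x]"] p(2) ne unfolding p12 by auto
        next
          case f: False
          then have "2 \<le> length p2" using False unfolding p12 by auto
          then have "ear G l (x # p2)"
            using path2 p(1) xl ne unfolding ear_def p12 by auto
          then show False using min[of "x # p2"] p(2) ne unfolding p12 by auto
        qed
      qed
      then show "x \<in> {hd p, last p}" unfolding p12 by auto
    qed
    then have "card (set p \<inter> A) \<le> card {hd p, last p}" by (intro card_mono) auto
    then show ?thesis using card_insert_le_m1[of 2 "{last p}" "hd p"] by simp
  qed
  then have "card A - 3 \<le> card (A - set p)"
    using card_Diff_subset_Int[of A "set p"] fA by (simp add: Int_commute)
  moreover have "t \<ge> 1" using T fT by (metis card_0_eq empty_iff not_less_eq_eq One_nat_def le0 le_antisym not_gr_zero Suc_leI)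
  ultimately have c: "2 * (t - 1) \<le> card (A - set p)" using A(2) by linarith
  obtain ls where ls: "set ls = T - {l}" "distinct ls"
    using finite_distinct_list[of "T - {l}"] fT by blast
  have len: "length ls = t - 1" using ls T distinct_card[of ls] by (simp add: card_Diff_singleton_if)
  obtain ps where ps: "length ps = t - 1" "\<forall>p\<in>set ps. ear G l p" "distinct (concat ps)"
    "set (concat ps) \<subseteq> (A - set p) \<union> (T - {l})"
  proof -
    have "A - set p \<subseteq> nbrs G m" if "m \<in> T" for m using A(1)[OF that] by blast
    then have "\<exists>ps. length ps = length ls \<and> (\<forall>p\<in>set ps. ear G l p) \<and> distinct (concat ps)
           \<and> set (concat ps) \<subseteq> (A - set p) \<union> set ls"
      using T(1,3) fA c len ls(1) by (intro hub_ears[OF G ls(2)]) auto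
    then show ?thesis using that unfolding len ls(1) by blast
  qed
  have "l \<notin> A" using A(1)[OF T(3)] not_self_nbr[OF G] by blast
  then have "distinct (l # concat (p # ps))"
    using ps(3,4) p T(3) by (auto simp: ear_def is_path_def simp del: set_concat)
  then have "flower G l (p # ps)" using ps(2) p(1) by (simp add: flower_def)
  then show ?thesis using ps(1) \<open>t \<ge> 1\<close> by (intro exI[of _ l] exI[of _ "p # ps"]) simp
qed

section \<open>Components outside the hub\<close>

text \<open>
  The component of \<open>v\<close> in the graph without \<open>T\<close>, provided that \<open>v\<close> is not in \<open>T\<close>.
\<close>

definition comp_without :: "'a pair_pre_digraph \<Rightarrow> 'a set \<Rightarrow> 'a \<Rightarrow> 'a set" where
  "comp_without G T v = {w. (v, w) \<in> {(x, y) \<in> parcs G. x \<notin> T \<and> y \<notin> T}\<^sup>*}"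

text \<open>
  A walk becomes a path by returning to the earlier visit whenever a vertex is repeated.
\<close>

lemma comp_without_path:
  assumes "w \<in> comp_without G T v" "v \<in> pverts G - T" "pair_graph G"
  shows "\<exists>p. is_path G p \<and> p \<noteq> [] \<and> hd p = v \<and> last p = w \<and> set p \<inter> T = {}"
  using assms(1) unfolding comp_without_def mem_Collect_eq
proof (induction rule: rtrancl_induct)
  case base
  show ?case using assms(2) by (intro exI[of _ "[v]"]) (auto simp: is_path_def)
next
  case (step y z)
  then obtain p where p: "is_path G p" "p \<noteq> []" "hd p = v" "last p = y" "set p \<inter> T = {}" by blast
  show ?case
  proof (cases "z \<in> set p")
    case True
    then obtain p1 p2 where "p = p1 @ z # p2" using split_list by metis
    then show ?thesis using p is_path_append[of G "p1 @ [z]" p2]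
      by (intro exI[of _ "p1 @ [z]"]) (auto simp: hd_append split: if_splits)
  next
    case False
    then show ?thesis using p step.hyps(2) pair_graphD(2)[OF assms(3)]
      by (intro exI[of _ "p @ [z]"]) (auto simp: is_path_def successively_append_iff)
  qed
qed

lemma comp_without_subset:
  assumes "pair_graph G" "v \<in> pverts G - T"
  shows "comp_without G T v \<subseteq> pverts G - T"
proof
  fix w assume "w \<in> comp_without G T v"
  from comp_without_path[OF this assms(2,1)] show "w \<in> pverts G - T"
    by (auto simp: is_path_def dest: last_in_set)
qed

lemma comp_without_step:
  assumes "w \<in> comp_without G T v" "u \<in> nbrs G w" "w \<notin> T" "u \<notin> T"
  shows "u \<in> comp_without G T v"
  using assms unfolding comp_without_def nbrs_def by (auto intro: rtrancl_into_rtrancl)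

lemma comp_without_sym:
  assumes "pair_graph G" "w \<in> comp_without G T v"
  shows "v \<in> comp_without G T w"
proof -
  have "sym {(x, y) \<in> parcs G. x \<notin> T \<and> y \<notin> T}"
    using pair_graphD(3)[OF assms(1)] by (auto intro!: symI)
  then show ?thesis using assms(2) unfolding comp_without_def by (auto dest: sym_rtrancl symD)
qed

text \<open>
  Two neighbours of \<open>l\<close> in one component are joined by a path that avoids \<open>T\<close>; unless it is a
  single edge, it is an ear.
\<close>

lemma comp_without_nbrs_adjacent:
  assumes G: "pair_graph G" and v: "v \<in> pverts G - T"
    and noear: "\<And>p. ear G l p \<Longrightarrow> set p \<inter> T \<noteq> {}"
    and uw: "u \<in> comp_without G T v" "w \<in> comp_without G T v" "u \<noteq> w" "u \<in> nbrs G l" "w \<in> nbrs G l"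
  shows "(u, w) \<in> parcs G"
proof -
  have "w \<in> comp_without G T u"
    using uw(2) comp_without_sym[OF G uw(1)] unfolding comp_without_def by auto
  moreover have "u \<in> pverts G - T" using uw(1) comp_without_subset[OF G v] by blast
  ultimately obtain p where p: "is_path G p" "p \<noteq> []" "hd p = u" "last p = w" "set p \<inter> T = {}"
    using comp_without_path[OF _ _ G] by metis
  have "\<not> 3 \<le> length p" using noear[of p] p uw(4,5) by (auto simp: ear_def)
  moreover have "length p \<noteq> 1" "length p \<noteq> 0" using p uw(3) by (auto simp: length_Suc_conv)
  ultimately have "length p = 2" by linarith
  then obtain x y where "p = [x, y]" by (auto simp: length_Suc_conv numeral_2_eq_2)
  then show ?thesis using p by (auto simp: is_path_def)
qed

text \<open>
  Three neighbours of \<open>l\<close> in one component would be pairwise adjacent and so form an ear.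
\<close>

lemma card_nbrs_comp_without:
  assumes G: "pair_graph G" and v: "v \<in> pverts G - T"
    and noear: "\<And>p. ear G l p \<Longrightarrow> set p \<inter> T \<noteq> {}"
  shows "card (nbrs G l \<inter> comp_without G T v) \<le> 2"
proof (rule ccontr)
  let ?X = "nbrs G l \<inter> comp_without G T v"
  assume "\<not> card ?X \<le> 2"
  then have "3 \<le> card ?X" by simp
  then obtain S where "S \<subseteq> ?X" "card S = 3" by (metis obtain_subset_with_card_n)
  then obtain a b c where abc: "{a, b, c} \<subseteq> ?X" "a \<noteq> b" "a \<noteq> c" "b \<noteq> c"
    by (auto simp: card_3_iff)
  have "(a, b) \<in> parcs G" "(b, c) \<in> parcs G"
    using comp_without_nbrs_adjacent[OF G v noear] abc by auto
  moreover have "{a, b, c} \<subseteq> pverts G - T" using abc comp_without_subset[OF G v] by blast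
  ultimately have "ear G l [a, b, c]" using abc by (auto simp: ear_def is_path_def)
  then show False using noear[of "[a, b, c]"] \<open>{a, b, c} \<subseteq> pverts G - T\<close> by auto
qed

section \<open>Rayleigh principle and nonnegative eigenfunctions\<close>

definition nbr_sum :: "'a pair_pre_digraph \<Rightarrow> ('a \<Rightarrow> real) \<Rightarrow> 'a \<Rightarrow> real" where
  "nbr_sum G x v = (\<Sum>w\<in>nbrs G v. x w)"

text \<open>
  The quadratic form of the adjacency matrix: every edge contributes twice.
\<close>

definition arc_form :: "'a pair_pre_digraph \<Rightarrow> ('a \<Rightarrow> real) \<Rightarrow> real" where
  "arc_form G x = (\<Sum>(v, w)\<in>parcs G. x v * x w)"

definition sq_norm_on :: "'a set \<Rightarrow> ('a \<Rightarrow> real) \<Rightarrow> real" where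
  "sq_norm_on S x = (\<Sum>v\<in>S. (x v)\<^sup>2)"

definition eigenfunction :: "'a pair_pre_digraph \<Rightarrow> real \<Rightarrow> ('a \<Rightarrow> real) \<Rightarrow> bool" where
  "eigenfunction G k x \<longleftrightarrow> (\<forall>v\<in>pverts G. nbr_sum G x v = k * x v)"

lemma finite_parcs: "pair_graph G \<Longrightarrow> finite (parcs G)"
  using pair_graphD(1)[of G] pair_graphD(2)[of G] by (meson finite_SigmaI finite_subset)

lemma parcs_Sigma: "pair_graph G \<Longrightarrow> parcs G = Sigma (pverts G) (nbrs G)"
  using pair_graphD(2)[of G] by (auto simp: nbrs_def)

lemma sum_parcs:
  assumes "pair_graph G"
  shows "(\<Sum>(v, w)\<in>parcs G. f v w) = (\<Sum>v\<in>pverts G. \<Sum>w\<in>nbrs G v. f v w)"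
  unfolding parcs_Sigma[OF assms]
  using pair_graphD(1)[OF assms] finite_nbrs(1)[OF assms] by (subst sum.Sigma) auto

lemma sum_parcs_swap:
  assumes "pair_graph G"
  shows "(\<Sum>(v, w)\<in>parcs G. f v w) = (\<Sum>(v, w)\<in>parcs G. f w v)"
  by (rule sum.reindex_bij_witness[of _ prod.swap prod.swap])
     (use pair_graphD(3)[OF assms] in auto)

lemma arc_form_nbr_sum:
  "pair_graph G \<Longrightarrow> arc_form G x = (\<Sum>v\<in>pverts G. x v * nbr_sum G x v)"
  unfolding arc_form_def nbr_sum_def by (simp add: sum_parcs sum_distrib_left)

lemma spectrum_adj_matrix_eigenfunction:
  assumes "pair_graph G"
  shows "spectrum (adj_matrix G) = {k. \<exists>x. (\<exists>v\<in>pverts G. x v \<noteq> 0) \<and> eigenfunction G k x}"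
proof -
  have "(\<Sum>w\<in>pverts G. if (v, w) \<in> parcs G then x w else 0) = nbr_sum G x v" for x :: "'a \<Rightarrow> real" and v
  proof -
    have "nbrs G v = {w \<in> pverts G. (v, w) \<in> parcs G}"
      using finite_nbrs(2)[OF assms] by (auto simp: nbrs_def)
    then show ?thesis
      unfolding nbr_sum_def using pair_graphD(1)[OF assms] by (simp add: sum.inter_filter)
  qed
  then show ?thesis
    unfolding spectrum_def adj_matrix_def eigenvalue_adj_matrix_wrt[OF vertex_list[OF assms]]
      eigenfunction_def by simp
qed

lemma finite_spectrum_adj_matrix: "finite (spectrum (adj_matrix G))"
proof -
  have "adj_matrix G \<in> carrier_mat (length (vertex_list G)) (length (vertex_list G))"
    by (simp add: adj_matrix_def adj_matrix_wrt_def)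
  then show ?thesis by (rule card_finite_spectrum(1))
qed

text \<open>
  The unit sphere lies in a product of compact intervals, where coordinates outside the vertex set are
  pinned to zero to obtain a compact subset of the function space.
\<close>

lemma arc_form_attains_max:
  assumes G: "pair_graph G" and ne: "pverts G \<noteq> {}"
  shows "\<exists>y. sq_norm_on (pverts G) y = 1 \<and>
    (\<forall>z. sq_norm_on (pverts G) z = 1 \<longrightarrow> arc_form G z \<le> arc_form G y)"
proof -
  let ?V = "pverts G"
  have fV: "finite ?V" using pair_graphD(1)[OF G] .
  define K where "K = (\<Pi>\<^sub>E v\<in>UNIV. if v \<in> ?V then {-1..1::real} else {0})"
  have "compactin (product_topology (\<lambda>_. euclidean) UNIV) K"
    unfolding K_def compactin_PiE by auto
  then have "compact K" by (simp add: euclidean_product_topology)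
  have coord: "continuous_on A (\<lambda>y :: 'a \<Rightarrow> real. y v)" for A v
    by (rule continuous_on_product_coordinates[THEN continuous_on_subset]) simp
  have "closed {y. sq_norm_on ?V y = 1}"
    unfolding sq_norm_on_def by (intro closed_Collect_eq continuous_intros coord)
  with \<open>compact K\<close> have comp: "compact (K \<inter> {y. sq_norm_on ?V y = 1})"
    by (rule compact_Int_closed)
  obtain u where u: "u \<in> ?V" using ne by blast
  have restrict: "(\<lambda>v. if v \<in> ?V then z v else 0) \<in> K \<inter> {y. sq_norm_on ?V y = 1}"
    if "sq_norm_on ?V z = 1" for z
  proof -
    have "\<bar>z v\<bar> \<le> 1" if "v \<in> ?V" for v
    proof -
      have "(z v)\<^sup>2 \<le> (\<Sum>v\<in>?V. (z v)\<^sup>2)" using that fV by (intro member_le_sum) auto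
      then show ?thesis using \<open>sq_norm_on ?V z = 1\<close>
        by (simp add: sq_norm_on_def abs_square_le_1)
    qed
    moreover have "sq_norm_on ?V (\<lambda>v. if v \<in> ?V then z v else 0) = sq_norm_on ?V z"
      by (simp add: sq_norm_on_def)
    ultimately show ?thesis using that by (auto simp: K_def abs_le_iff)
  qed
  have form: "arc_form G (\<lambda>v. if v \<in> ?V then z v else 0) = arc_form G z" for z
    unfolding arc_form_def using pair_graphD(2)[OF G] by (intro sum.cong) auto
  have "sq_norm_on ?V (\<lambda>v. if v = u then 1 else 0) = (\<Sum>v\<in>?V. if v = u then 1 else 0)"
    unfolding sq_norm_on_def by (intro sum.cong) auto
  then have "sq_norm_on ?V (\<lambda>v. if v = u then 1 else 0) = 1" using fV u by simp
  from restrict[OF this] have nonempty: "K \<inter> {y. sq_norm_on ?V y = 1} \<noteq> {}" by blast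
  have "continuous_on (K \<inter> {y. sq_norm_on ?V y = 1}) (arc_form G)"
    unfolding arc_form_def case_prod_unfold by (intro continuous_intros coord)
  from continuous_attains_sup[OF comp nonempty this]
  obtain y where "sq_norm_on ?V y = 1"
    and "\<forall>z\<in>K \<inter> {y. sq_norm_on ?V y = 1}. arc_form G z \<le> arc_form G y" by blast
  then show ?thesis using restrict form by metis
qed

lemma arc_form_add:
  assumes G: "pair_graph G"
  shows "arc_form G (\<lambda>v. y v + e * h v) =
    arc_form G y + 2 * e * (\<Sum>v\<in>pverts G. h v * nbr_sum G y v) + e\<^sup>2 * arc_form G h"
proof -
  have "(\<Sum>v\<in>pverts G. h v * nbr_sum G y v) = (\<Sum>(v, w)\<in>parcs G. h v * y w)"
    unfolding nbr_sum_def sum_parcs[OF G] by (simp add: sum_distrib_left)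
  moreover from this have "(\<Sum>v\<in>pverts G. h v * nbr_sum G y v) = (\<Sum>(v, w)\<in>parcs G. h w * y v)"
    using sum_parcs_swap[OF G, of "\<lambda>v w. h v * y w"] by simp
  moreover have "arc_form G (\<lambda>v. y v + e * h v) = (\<Sum>(v, w)\<in>parcs G. y v * y w)
      + e * (\<Sum>(v, w)\<in>parcs G. h v * y w) + e * (\<Sum>(v, w)\<in>parcs G. h w * y v)
      + e\<^sup>2 * (\<Sum>(v, w)\<in>parcs G. h v * h w)"
    unfolding arc_form_def sum_distrib_left sum.distrib[symmetric]
    by (intro sum.cong) (auto simp: algebra_simps power2_eq_square)
  ultimately show ?thesis unfolding arc_form_def by simp
qed

text \<open>
  First variation: moving from the maximiser \<open>y\<close> in the direction \<open>h\<close> of the defect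
  \<open>A y - k y\<close> changes \<open>arc_form - k * sq_norm\<close> at first order by twice the squared norm of
  \<open>h\<close>, which cannot be positive.
\<close>

lemma form_maximiser_eigenfunction:
  assumes G: "pair_graph G" and le: "\<And>z. arc_form G z \<le> k * sq_norm_on (pverts G) z"
    and eq: "arc_form G y = k * sq_norm_on (pverts G) y"
  shows "eigenfunction G k y"
proof -
  let ?V = "pverts G"
  define h where "h v = nbr_sum G y v - k * y v" for v
  define s where "s = sq_norm_on ?V h"
  define c where "c = k * s - arc_form G h"
  have s: "s = (\<Sum>v\<in>?V. h v * nbr_sum G y v) - k * (\<Sum>v\<in>?V. h v * y v)"
    unfolding s_def sq_norm_on_def sum_distrib_left sum_subtractf[symmetric]
    by (intro sum.cong) (auto simp: h_def algebra_simps power2_eq_square)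
  have var: "2 * e * s \<le> e\<^sup>2 * c" for e
  proof -
    have "sq_norm_on ?V (\<lambda>v. y v + e * h v) =
        sq_norm_on ?V y + 2 * e * (\<Sum>v\<in>?V. h v * y v) + e\<^sup>2 * s"
      unfolding s_def sq_norm_on_def sum_distrib_left sum.distrib[symmetric]
      by (intro sum.cong) (auto simp: algebra_simps power2_eq_square)
    then have "arc_form G y + 2 * e * (\<Sum>v\<in>?V. h v * nbr_sum G y v) + e\<^sup>2 * arc_form G h
        \<le> k * (sq_norm_on ?V y + 2 * e * (\<Sum>v\<in>?V. h v * y v) + e\<^sup>2 * s)"
      using le[of "\<lambda>v. y v + e * h v"] unfolding arc_form_add[OF G] by simp
    then show ?thesis using eq unfolding c_def by (simp add: s algebra_simps)
  qed
  have "s \<ge> 0" unfolding s_def sq_norm_on_def by (intro sum_nonneg) auto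
  have "s = 0"
  proof (rule ccontr)
    assume "s \<noteq> 0"
    with \<open>s \<ge> 0\<close> have "s > 0" by simp
    \<comment> \<open>A step so short that the second-order term is at most half of the first-order term.\<close>
    define e where "e = s / (\<bar>c\<bar> + 1)"
    have e: "e > 0" using \<open>s > 0\<close> by (simp add: e_def add_pos_nonneg)
    have "e * (2 * s) \<le> e * (e * c)" using var[of e] by (simp add: power2_eq_square algebra_simps)
    then have "2 * s \<le> e * c" using e by (simp only: mult_le_cancel_left_pos)
    also have "e * c \<le> e * (\<bar>c\<bar> + 1)" using e by (intro mult_left_mono) auto
    also have "\<dots> = s" by (simp add: e_def)
    finally show False using \<open>s > 0\<close> by simp
  qed
  then have "\<forall>v\<in>?V. (h v)\<^sup>2 = 0"
    unfolding s_def sq_norm_on_def using pair_graphD(1)[OF G] by (subst (asm) sum_nonneg_eq_0_iff) auto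
  then show ?thesis unfolding eigenfunction_def h_def by auto
qed

lemma eigenfunction_arc_form:
  assumes "pair_graph G" "eigenfunction G k x"
  shows "arc_form G x = k * sq_norm_on (pverts G) x"
  unfolding arc_form_nbr_sum[OF assms(1)] sq_norm_on_def sum_distrib_left
  using assms(2) by (intro sum.cong) (auto simp: eigenfunction_def power2_eq_square)

text \<open>
  The maximum of the form on the unit sphere is an eigenvalue and bounds all other eigenvalues, hence it
  is the spectral radius.  As arcs have nonnegative weight, passing to absolute values keeps a
  maximiser maximal.  On a
  disconnected graph the eigenfunction may vanish somewhere.
\<close>

theorem spectral_radius_Rayleigh:
  assumes G: "pair_graph G" and ne: "pverts G \<noteq> {}"
  shows "arc_form G z \<le> \<rho> G * sq_norm_on (pverts G) z"
    and "\<exists>x. (\<forall>v\<in>pverts G. 0 \<le> x v) \<and> (\<exists>v\<in>pverts G. 0 < x v) \<and> eigenfunction G (\<rho> G) x"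
proof -
  let ?V = "pverts G"
  have fV: "finite ?V" using pair_graphD(1)[OF G] .
  obtain y where y: "sq_norm_on ?V y = 1"
    and ymax: "\<And>z. sq_norm_on ?V z = 1 \<Longrightarrow> arc_form G z \<le> arc_form G y"
    using arc_form_attains_max[OF G ne] by blast
  define k where "k = arc_form G y"
  have le: "arc_form G z \<le> k * sq_norm_on ?V z" for z
  proof (cases "sq_norm_on ?V z = 0")
    case True
    then have "\<forall>v\<in>?V. (z v)\<^sup>2 = 0"
      unfolding sq_norm_on_def using fV by (subst (asm) sum_nonneg_eq_0_iff) auto
    then have "arc_form G z = 0" unfolding arc_form_nbr_sum[OF G] by simp
    then show ?thesis using True by simp
  next
    case False
    moreover have "sq_norm_on ?V z \<ge> 0" unfolding sq_norm_on_def by (intro sum_nonneg) auto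
    ultimately have pos: "sq_norm_on ?V z > 0" by simp
    define r where "r = sqrt (sq_norm_on ?V z)"
    have r: "r > 0" "r\<^sup>2 = sq_norm_on ?V z" using pos by (auto simp: r_def)
    have "sq_norm_on ?V (\<lambda>v. z v / r) = sq_norm_on ?V z / r\<^sup>2"
      unfolding sq_norm_on_def by (simp add: power_divide sum_divide_distrib)
    then have "sq_norm_on ?V (\<lambda>v. z v / r) = 1" using r pos by simp
    moreover have "arc_form G (\<lambda>v. z v / r) = arc_form G z / r\<^sup>2"
      unfolding arc_form_def sum_divide_distrib
      by (intro sum.cong) (auto simp: power2_eq_square)
    ultimately have "arc_form G z / r\<^sup>2 \<le> k" using ymax[of "\<lambda>v. z v / r"] by (simp add: k_def)
    then show ?thesis using r pos by (simp add: divide_le_eq)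
  qed
  define x where "x v = \<bar>y v\<bar>" for v
  have x1: "sq_norm_on ?V x = 1" using y by (simp add: sq_norm_on_def x_def)
  have "arc_form G y \<le> arc_form G x"
    unfolding arc_form_def x_def by (intro sum_mono) (auto simp flip: abs_mult)
  then have "arc_form G x = k" using ymax[OF x1] by (simp add: k_def)
  then have eig: "eigenfunction G k x"
    using form_maximiser_eigenfunction[OF G le, of x] x1 by simp
  have pos: "\<exists>v\<in>?V. 0 < x v"
  proof (rule ccontr)
    assume "\<not> (\<exists>v\<in>?V. 0 < x v)"
    then have "\<forall>v\<in>?V. x v = 0" by (auto simp: x_def)
    then show False using x1 by (simp add: sq_norm_on_def)
  qed
  have "\<exists>v\<in>?V. x v \<noteq> 0" using pos by (metis less_irrefl)
  then have kin: "k \<in> spectrum (adj_matrix G)"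
    unfolding spectrum_adj_matrix_eigenfunction[OF G] using eig by blast
  have "k' \<le> k" if k': "k' \<in> spectrum (adj_matrix G)" for k'
  proof -
    obtain z where z: "\<exists>v\<in>?V. z v \<noteq> 0" "eigenfunction G k' z"
      using k' unfolding spectrum_adj_matrix_eigenfunction[OF G] by blast
    have "sq_norm_on ?V z \<ge> 0" unfolding sq_norm_on_def by (intro sum_nonneg) auto
    moreover have "sq_norm_on ?V z \<noteq> 0"
      using z(1) fV unfolding sq_norm_on_def by (subst sum_nonneg_eq_0_iff) auto
    moreover have "k' * sq_norm_on ?V z \<le> k * sq_norm_on ?V z"
      using le[of z] eigenfunction_arc_form[OF G z(2)] by simp
    ultimately show ?thesis by simp
  qed
  then have "\<rho> G = k"
    unfolding graph_spectral_radius_def by (intro Max_eqI finite_spectrum_adj_matrix kin)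
  then show "arc_form G z \<le> \<rho> G * sq_norm_on ?V z"
    and "\<exists>x. (\<forall>v\<in>?V. 0 \<le> x v) \<and> (\<exists>v\<in>?V. 0 < x v) \<and> eigenfunction G (\<rho> G) x"
    using le eig pos by (auto simp: x_def intro!: exI[of _ x])
qed

lemma spectrum_iso_subset:
  assumes G: "pair_graph G" and H: "pair_graph H"
    and bij: "bij_betw f (pverts G) (pverts H)"
    and adj: "\<forall>u\<in>pverts G. \<forall>v\<in>pverts G. (u, v) \<in> parcs G \<longleftrightarrow> (f u, f v) \<in> parcs H"
  shows "spectrum (adj_matrix H) \<subseteq> spectrum (adj_matrix G)"
proof
  fix k assume "k \<in> spectrum (adj_matrix H)"
  then obtain x where x: "\<exists>v\<in>pverts H. x v \<noteq> 0" "eigenfunction H k x"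
    unfolding spectrum_adj_matrix_eigenfunction[OF H] by blast
  have img: "f ` pverts G = pverts H" and inj: "inj_on f (pverts G)"
    using bij by (auto simp: bij_betw_def)
  have "nbr_sum G (\<lambda>v. x (f v)) v = k * x (f v)" if v: "v \<in> pverts G" for v
  proof -
    have "nbrs H (f v) = f ` nbrs G v"
    proof (intro equalityI subsetI)
      fix w assume w: "w \<in> nbrs H (f v)"
      then obtain u where "u \<in> pverts G" "w = f u" using finite_nbrs(2)[OF H] img by blast
      then show "w \<in> f ` nbrs G v" using w adj v by (auto simp: nbrs_def)
    next
      fix w assume "w \<in> f ` nbrs G v"
      then obtain u where "u \<in> nbrs G v" "w = f u" by blast
      then show "w \<in> nbrs H (f v)" using finite_nbrs(2)[OF G, of v] adj v by (auto simp: nbrs_def)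
    qed
    moreover have "inj_on f (nbrs G v)" using inj finite_nbrs(2)[OF G] inj_on_subset by blast
    ultimately have "nbr_sum G (\<lambda>v. x (f v)) v = nbr_sum H x (f v)"
      unfolding nbr_sum_def by (simp add: sum.reindex)
    then show ?thesis using x(2) v img by (auto simp: eigenfunction_def)
  qed
  moreover have "\<exists>v\<in>pverts G. x (f v) \<noteq> 0" using x(1) unfolding img[symmetric] by blast
  ultimately show "k \<in> spectrum (adj_matrix G)"
    unfolding spectrum_adj_matrix_eigenfunction[OF G] eigenfunction_def
    by (auto intro!: exI[of _ "\<lambda>v. x (f v)"])
qed

lemma spectral_radius_iso:
  assumes G: "pair_graph G" and H: "pair_graph H" and iso: "G \<cong>\<^sub>g H"
  shows "\<rho> G = \<rho> H"
proof -
  obtain f where f: "bij_betw f (pverts G) (pverts H)"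
    "\<forall>u\<in>pverts G. \<forall>v\<in>pverts G. (u, v) \<in> parcs G \<longleftrightarrow> (f u, f v) \<in> parcs H"
    using iso graph_iso_iff[OF G H] by blast
  let ?g = "inv_into (pverts G) f"
  have g: "bij_betw ?g (pverts H) (pverts G)" using f(1) by (rule bij_betw_inv_into)
  have "\<forall>u\<in>pverts H. \<forall>v\<in>pverts H. (u, v) \<in> parcs H \<longleftrightarrow> (?g u, ?g v) \<in> parcs G"
    using f g bij_betw_inv_into_right[OF f(1)] bij_betwE[OF g] by simp
  then have "spectrum (adj_matrix G) = spectrum (adj_matrix H)"
    using spectrum_iso_subset[OF G H f] spectrum_iso_subset[OF H G g] by blast
  then show ?thesis by (simp add: graph_spectral_radius_def)
qed

section \<open>Existence of the hub\<close>

lemma sum_degrees: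
  assumes "pair_graph G"
  shows "(\<Sum>v\<in>pverts G. card (nbrs G v)) = card (parcs G)"
  unfolding parcs_Sigma[OF assms]
  using pair_graphD(1)[OF assms] finite_nbrs(1)[OF assms] by simp

lemma eigenfunction_two_step:
  assumes "pair_graph G" "eigenfunction G r x" "v \<in> pverts G"
  shows "r\<^sup>2 * x v = (\<Sum>u\<in>nbrs G v. nbr_sum G x u)"
proof -
  have "(\<Sum>u\<in>nbrs G v. nbr_sum G x u) = (\<Sum>u\<in>nbrs G v. r * x u)"
    using assms(2) finite_nbrs(2)[OF assms(1)] by (intro sum.cong) (auto simp: eigenfunction_def)
  also have "\<dots> = r * nbr_sum G x v" by (simp add: nbr_sum_def sum_distrib_left)
  also have "\<dots> = r * (r * x v)" using assms(2,3) by (simp add: eigenfunction_def)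
  finally show ?thesis by (simp add: power2_eq_square)
qed

text \<open>
  Summing the eigenvalue equation over all vertices bounds the total mass of \<open>x\<close> by the number of arcs
  divided by \<open>r\<close>.
\<close>

lemma few_large_entries:
  fixes r e :: real
  assumes G: "pair_graph G" and eig: "eigenfunction G r x"
    and x: "\<And>v. v \<in> pverts G \<Longrightarrow> 0 \<le> x v \<and> x v \<le> 1"
    and r: "r > 0" and e: "e > 0"
  shows "e * r * card {v \<in> pverts G. e \<le> x v} \<le> card (parcs G)"
proof -
  let ?P = "{v \<in> pverts G. e \<le> x v}"
  have fV: "finite (pverts G)" using pair_graphD(1)[OF G] .
  have "e * card ?P = (\<Sum>v\<in>?P. e)" by simp
  also have "\<dots> \<le> (\<Sum>v\<in>?P. x v)" by (intro sum_mono) auto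
  also have "\<dots> \<le> (\<Sum>v\<in>pverts G. x v)" using fV x by (intro sum_mono2) auto
  finally have "e * r * card ?P \<le> r * (\<Sum>v\<in>pverts G. x v)"
    using r by (simp add: mult.assoc mult.left_commute)
  also have "\<dots> = (\<Sum>v\<in>pverts G. nbr_sum G x v)"
    using eig by (simp add: eigenfunction_def sum_distrib_left)
  also have "\<dots> \<le> (\<Sum>v\<in>pverts G. real (card (nbrs G v)))"
  proof (rule sum_mono)
    fix v
    have "nbr_sum G x v \<le> (\<Sum>w\<in>nbrs G v. 1)"
      unfolding nbr_sum_def using x finite_nbrs(2)[OF G] by (intro sum_mono) blast
    then show "nbr_sum G x v \<le> real (card (nbrs G v))" by simp
  qed
  also have "\<dots> = real (card (parcs G))" using sum_degrees[OF G] by (metis of_nat_sum)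
  finally show ?thesis .
qed

text \<open>
  By the eigenvalue equation applied twice, \<open>r\<^sup>2 * x v\<close> is a sum of entries over the walks of length
  two from \<open>v\<close>.  Walks that end in a small entry contribute little, because there are only linearly
  many.  The set \<open>P\<close> of large entries is small, so the walks ending there are few by the density bound on
  the union of \<open>P\<close> with the neighbourhood of \<open>v\<close>.
\<close>

lemma low_degree_small_entry:
  fixes r e n :: real and t :: nat
  assumes G: "pair_graph G"
    and dens: "\<And>S. S \<subseteq> pverts G \<Longrightarrow> card (parcs G \<inter> S \<times> S) \<le> 6 * t * card S"
    and eig: "eigenfunction G r x"
    and x: "\<And>v. v \<in> pverts G \<Longrightarrow> 0 \<le> x v \<and> x v \<le> 1"
    and r: "r > 0" "r\<^sup>2 \<ge> t * n / 2" and n: "n = real (card (pverts G))"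
    and t: "t \<ge> 1" and e: "e > 0" "6 * t \<le> e\<^sup>2 * r"
    and v: "v \<in> pverts G" "card (nbrs G v) \<le> e * n"
  shows "x v \<le> 36 * e"
proof -
  let ?V = "pverts G"
  define P where "P = {w \<in> ?V. e \<le> x w}"
  have fV: "finite ?V" using pair_graphD(1)[OF G] .
  have fP: "finite P" using fV by (simp add: P_def)
  have "parcs G \<inter> ?V \<times> ?V = parcs G" using pair_graphD(2)[OF G] by blast
  then have "card (parcs G) \<le> 6 * t * card ?V" using dens[of ?V] by simp
  then have "real (card (parcs G)) \<le> real (6 * t * card ?V)" by (simp only: of_nat_le_iff)
  then have arcs: "real (card (parcs G)) \<le> 6 * t * n" by (simp add: n)
  have n0: "n > 0" using v(1) fV unfolding n by (metis card_gt_0_iff empty_iff of_nat_0_less_iff)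
  have cP: "card P \<le> e * n"
  proof -
    have "e * r * card P \<le> 6 * t * n"
      using few_large_entries[OF G eig x r(1) e(1)] arcs by (simp add: P_def)
    also have "\<dots> \<le> e\<^sup>2 * r * n" using e(2) n0 by (intro mult_right_mono) auto
    also have "\<dots> = e * r * (e * n)" by (simp add: power2_eq_square)
    finally show ?thesis using e(1) r(1) by simp
  qed
  let ?N = "nbrs G v"
  have fN: "finite ?N" "?N \<subseteq> ?V" using finite_nbrs[OF G] by auto
  have "nbr_sum G x u \<le> e * card (nbrs G u) + card (nbrs G u \<inter> P)" if "u \<in> ?N" for u
  proof -
    have "nbr_sum G x u \<le> (\<Sum>w\<in>nbrs G u. e + of_bool (w \<in> P))"
      unfolding nbr_sum_def
    proof (rule sum_mono)
      fix w assume "w \<in> nbrs G u"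
      then have "w \<in> ?V" using finite_nbrs(2)[OF G] by blast
      then show "x w \<le> e + of_bool (w \<in> P)" using x[of w] e(1) by (auto simp: P_def)
    qed
    also have "\<dots> = e * card (nbrs G u) + card (nbrs G u \<inter> P)"
      using finite_nbrs(1)[OF G, of u] by (simp add: sum.distrib Int_def of_bool_def flip: sum.inter_filter)
    finally show ?thesis .
  qed
  then have "r\<^sup>2 * x v \<le> (\<Sum>u\<in>?N. e * card (nbrs G u) + card (nbrs G u \<inter> P))"
    unfolding eigenfunction_two_step[OF G eig v(1)] by (rule sum_mono)
  also have "\<dots> = e * (\<Sum>u\<in>?N. card (nbrs G u)) + (\<Sum>u\<in>?N. card (nbrs G u \<inter> P))"
    by (simp add: sum.distrib sum_distrib_left)
  also have "(\<Sum>u\<in>?N. card (nbrs G u \<inter> P)) = card (SIGMA u : ?N. nbrs G u \<inter> P)"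
    using fN(1) fP by simp
  also have "\<dots> \<le> card (parcs G \<inter> (?N \<union> P) \<times> (?N \<union> P))"
    using fN fP by (intro card_mono finite_Int disjI2) (auto simp: nbrs_def)
  also have "\<dots> \<le> 6 * t * (card ?N + card P)"
    using dens[of "?N \<union> P"] fN(2) card_Un_le[of ?N P]
    by (auto simp: P_def intro: order_trans[OF _ mult_left_mono])
  also have "real (6 * t * (card ?N + card P)) \<le> 6 * t * (e * n + e * n)"
    using v(2) cP by (simp only: of_nat_mult of_nat_add of_nat_numeral) (intro mult_left_mono add_mono, auto)
  also have "e * (\<Sum>u\<in>?N. card (nbrs G u)) \<le> e * (6 * t * n)"
  proof -
    have "(\<Sum>u\<in>?N. card (nbrs G u)) \<le> card (parcs G)"
      unfolding sum_degrees[OF G, symmetric] using fV fN by (intro sum_mono2) auto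
    then have "real (\<Sum>u\<in>nbrs G v. card (nbrs G u)) \<le> real (card (parcs G))" by (simp only: of_nat_le_iff)
    then have "real (\<Sum>u\<in>nbrs G v. card (nbrs G u)) \<le> 6 * t * n" using arcs by linarith
    then show ?thesis using e(1) by (intro mult_left_mono) auto
  qed
  finally have "r\<^sup>2 * x v \<le> 18 * e * (t * n)" by (simp add: algebra_simps)
  moreover have "t * n / 2 * x v \<le> r\<^sup>2 * x v" using r(2) x[OF v(1)] by (intro mult_right_mono) auto
  ultimately have "(t * n) * x v \<le> (t * n) * (36 * e)" by (simp add: algebra_simps)
  moreover have "t * n > 0" using t n0 by simp
  ultimately show ?thesis by (simp only: mult_le_cancel_left_pos)
qed

text \<open>
  Every such vertex is a common neighbour of one of the at most \<open>2 ^ card L\<close> many subsets of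
  \<open>L\<close> with \<open>t + 1\<close> elements.
\<close>

lemma few_vertices_with_many_nbrs_in:
  assumes G: "pair_graph G"
    and free: "\<And>T A. T \<subseteq> pverts G \<Longrightarrow> card T = Suc t \<Longrightarrow> (\<And>m. m \<in> T \<Longrightarrow> A \<subseteq> nbrs G m) \<Longrightarrow> card A < 2 * t"
    and L: "L \<subseteq> pverts G"
  shows "card {u \<in> pverts G. t < card (nbrs G u \<inter> L)} \<le> 2 ^ card L * (2 * t)"
proof -
  let ?W = "{u \<in> pverts G. t < card (nbrs G u \<inter> L)}"
  have fV: "finite (pverts G)" using pair_graphD(1)[OF G] .
  have fL: "finite L" using L fV finite_subset by blast
  define F where "F = {T. T \<subseteq> L \<and> card T = Suc t}"
  have fF: "finite F" unfolding F_def using fL by (auto intro: finite_subset[of _ "Pow L"])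
  have "?W \<subseteq> (\<Union>T\<in>F. {u \<in> pverts G. T \<subseteq> nbrs G u})"
  proof
    fix u assume u: "u \<in> ?W"
    then have "Suc t \<le> card (nbrs G u \<inter> L)" by simp
    then obtain T where "T \<subseteq> nbrs G u \<inter> L" "card T = Suc t" by (metis obtain_subset_with_card_n)
    then show "u \<in> (\<Union>T\<in>F. {u \<in> pverts G. T \<subseteq> nbrs G u})" using u by (auto simp: F_def)
  qed
  then have "card ?W \<le> card (\<Union>T\<in>F. {u \<in> pverts G. T \<subseteq> nbrs G u})"
    using fF fV by (intro card_mono) auto
  also have "\<dots> \<le> (\<Sum>T\<in>F. card {u \<in> pverts G. T \<subseteq> nbrs G u})" using fF by (rule card_UN_le)
  also have "\<dots> \<le> (\<Sum>T\<in>F. 2 * t)"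
  proof (rule sum_mono)
    fix T assume "T \<in> F"
    then have T: "T \<subseteq> pverts G" "card T = Suc t" using L by (auto simp: F_def)
    show "card {u \<in> pverts G. T \<subseteq> nbrs G u} \<le> 2 * t"
      by (rule less_imp_le, rule free[OF T]) (use nbrs_sym[OF G] in blast)
  qed
  also have "\<dots> = card F * (2 * t)" by simp
  also have "card F \<le> card (Pow L)" using fL by (intro card_mono) (auto simp: F_def)
  finally show ?thesis using fL by (simp add: card_Pow)
qed

text \<open>
  The set \<open>L\<close> of vertices of linear degree has bounded size, and all other entries are small.  In the
  expansion of \<open>r\<^sup>2 * x v\<close> over walks of length two only the walks ending in \<open>L\<close> matter, and
  apart from boundedly many vertices \<open>u\<close> each middle vertex \<open>u\<close> sees at most \<open>t\<close> vertices
  of \<open>L\<close>.  Since \<open>r\<^sup>2\<close> is about \<open>t * n\<close>, this has two consequences: a vertex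
  with an entry close to one has almost full degree, and, starting from the vertex \<open>z\<close> with the largest
  entry, at least \<open>t\<close> vertices of \<open>L\<close> have entries close to one.  The constant \<open>217\<close> is
  \<open>6 * 36\<close> from the small entries plus one for the terms that do not grow with \<open>n\<close>.
\<close>

lemma exists_hub:
  fixes r e d n :: real and t l :: nat
  assumes G: "pair_graph G"
    and dens: "\<And>S. S \<subseteq> pverts G \<Longrightarrow> card (parcs G \<inter> S \<times> S) \<le> 6 * t * card S"
    and free: "\<And>T A. T \<subseteq> pverts G \<Longrightarrow> card T = Suc t \<Longrightarrow> (\<And>m. m \<in> T \<Longrightarrow> A \<subseteq> nbrs G m) \<Longrightarrow> card A < 2 * t"
    and eig: "eigenfunction G r x"
    and x: "\<And>v. v \<in> pverts G \<Longrightarrow> 0 \<le> x v \<and> x v \<le> 1" and z: "z \<in> pverts G" "x z = 1"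
    and r: "r > 0" "r\<^sup>2 \<ge> t * (n - t)" and n: "n = real (card (pverts G))"
    and t: "t \<ge> 1" and e: "e > 0" "6 * t \<le> e\<^sup>2 * r" and d: "217 * t * e < d" "d \<le> 1"
    and l: "6 * t \<le> e * real l" and n_large: "2 * t \<le> n" "real t * t + 2 ^ l * (2 * t) * l \<le> t * e * n"
  shows "\<exists>T \<subseteq> pverts G. card T = t \<and> (\<forall>v\<in>T. 1 - d \<le> x v \<and> (1 - 2 * d) * n \<le> card (nbrs G v))"
proof -
  let ?V = "pverts G"
  have fV: "finite ?V" using pair_graphD(1)[OF G] .
  have n0: "n > 0" using z(1) fV unfolding n by (metis card_gt_0_iff empty_iff of_nat_0_less_iff)
  have "real t * n / 2 \<le> real t * (n - real t)"
  proof -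
    have "n / 2 \<le> n - real t" using n_large(1) by simp
    then show ?thesis using mult_left_mono[of "n / 2" "n - real t" "real t"] by simp
  qed
  then have r2: "r\<^sup>2 \<ge> t * n / 2" using r(2) by linarith
  have "parcs G \<inter> ?V \<times> ?V = parcs G" using pair_graphD(2)[OF G] by blast
  then have "card (parcs G) \<le> 6 * t * card ?V" using dens[of ?V] by simp
  then have "real (card (parcs G)) \<le> real (6 * t * card ?V)" by (simp only: of_nat_le_iff)
  then have arcs: "real (card (parcs G)) \<le> 6 * t * n" by (simp add: n)
  define L where "L = {v \<in> ?V. e * n < card (nbrs G v)}"
  have L: "L \<subseteq> ?V" and fL: "finite L" using fV by (auto simp: L_def)
  have small: "x v \<le> 36 * e" if "v \<in> ?V" "v \<notin> L" for v
    using that by (intro low_degree_small_entry[OF G dens eig x r(1) r2 n t e]) (auto simp: L_def)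
  have d0: "0 \<le> d" using d(1) mult_nonneg_nonneg[of "217 * real t" e] e(1) by linarith
  have cL: "card L \<le> l"
  proof -
    have "card L * (e * n) = (\<Sum>v\<in>L. e * n)" by simp
    also have "\<dots> \<le> (\<Sum>v\<in>L. real (card (nbrs G v)))" by (intro sum_mono) (auto simp: L_def)
    also have "\<dots> \<le> (\<Sum>v\<in>?V. real (card (nbrs G v)))" using fV L by (intro sum_mono2) auto
    also have "\<dots> = real (card (parcs G))" using sum_degrees[OF G] by (metis of_nat_sum)
    also have "\<dots> \<le> 6 * t * n" by (rule arcs)
    also have "\<dots> \<le> e * real l * n" using l n0 by (intro mult_right_mono) auto
    finally have "(e * n) * card L \<le> (e * n) * l" by (simp add: algebra_simps)
    then show ?thesis using e(1) n0 by simp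
  qed
  define W where "W = {u \<in> ?V. t < card (nbrs G u \<inter> L)}"
  have cW: "card W * card L \<le> 2 ^ l * (2 * t) * l"
  proof (rule mult_mono[OF _ cL])
    have "card W \<le> 2 ^ card L * (2 * t)"
      unfolding W_def by (rule few_vertices_with_many_nbrs_in[OF G free L])
    also have "\<dots> \<le> 2 ^ l * (2 * t)" using cL by (intro mult_right_mono power_increasing) auto
    finally show "card W \<le> 2 ^ l * (2 * t)" .
  qed auto
  have WL: "real t * t + card W * card L \<le> t * e * n"
  proof -
    have "real (card W * card L) \<le> real (2 ^ l * (2 * t) * l)" using cW by (simp only: of_nat_le_iff)
    then show ?thesis using n_large(2) by simp
  qed
  \<comment> \<open>Middle vertices outside the bounded set \<open>W\<close> see at most \<open>t\<close> vertices of \<open>L\<close>.\<close>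
  have count: "(\<Sum>u\<in>nbrs G v. card (nbrs G u \<inter> L)) \<le> t * card (nbrs G v) + card W * card L" for v
  proof -
    have fN: "finite (nbrs G v)" using finite_nbrs[OF G] by blast
    have "(\<Sum>u\<in>nbrs G v. card (nbrs G u \<inter> L)) \<le> (\<Sum>u\<in>nbrs G v. t + (if u \<in> W then card L else 0))"
    proof (rule sum_mono)
      fix u assume "u \<in> nbrs G v"
      then have "u \<in> ?V" using finite_nbrs(2)[OF G] by blast
      moreover have "card (nbrs G u \<inter> L) \<le> card L" using fL by (intro card_mono) auto
      ultimately show "card (nbrs G u \<inter> L) \<le> t + (if u \<in> W then card L else 0)"
        by (auto simp: W_def)
    qed
    also have "\<dots> = t * card (nbrs G v) + card (nbrs G v \<inter> W) * card L"
      using fN by (simp add: sum.distrib Int_def flip: sum.inter_filter)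
    also have "card (nbrs G v \<inter> W) \<le> card W" using fV by (intro card_mono) (auto simp: W_def)
    finally show ?thesis by simp
  qed
  have two: "r\<^sup>2 * x v \<le> (\<Sum>u\<in>nbrs G v. \<Sum>w\<in>nbrs G u \<inter> L. x w) + 216 * t * e * n" if v: "v \<in> ?V" for v
  proof -
    have fN: "finite (nbrs G v)" "nbrs G v \<subseteq> ?V" using finite_nbrs[OF G] by auto
    have "nbr_sum G x u \<le> (\<Sum>w\<in>nbrs G u \<inter> L. x w) + 36 * e * card (nbrs G u)" for u
    proof -
      have fu: "finite (nbrs G u)" using finite_nbrs[OF G] by blast
      have "nbr_sum G x u = (\<Sum>w\<in>nbrs G u \<inter> L. x w) + (\<Sum>w\<in>nbrs G u - L. x w)"
        unfolding nbr_sum_def by (rule sum.Int_Diff[OF fu])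
      also have "(\<Sum>w\<in>nbrs G u - L. x w) \<le> (\<Sum>w\<in>nbrs G u - L. 36 * e)"
        using small finite_nbrs(2)[OF G] by (intro sum_mono) blast
      also have "\<dots> \<le> 36 * e * card (nbrs G u)"
        using e(1) card_mono[OF fu, of "nbrs G u - L"] by simp
      finally show ?thesis by simp
    qed
    then have "r\<^sup>2 * x v \<le> (\<Sum>u\<in>nbrs G v. (\<Sum>w\<in>nbrs G u \<inter> L. x w) + 36 * e * card (nbrs G u))"
      unfolding eigenfunction_two_step[OF G eig v] by (intro sum_mono)
    also have "\<dots> = (\<Sum>u\<in>nbrs G v. \<Sum>w\<in>nbrs G u \<inter> L. x w) + 36 * e * (\<Sum>u\<in>nbrs G v. card (nbrs G u))"
      by (simp add: sum.distrib sum_distrib_left)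
    also have "36 * e * (\<Sum>u\<in>nbrs G v. card (nbrs G u)) \<le> 36 * e * (6 * t * n)"
    proof -
      have "(\<Sum>u\<in>nbrs G v. card (nbrs G u)) \<le> card (parcs G)"
        unfolding sum_degrees[OF G, symmetric] using fV fN by (intro sum_mono2) auto
      then have "real (\<Sum>u\<in>nbrs G v. card (nbrs G u)) \<le> real (card (parcs G))" by (simp only: of_nat_le_iff)
      then have "real (\<Sum>u\<in>nbrs G v. card (nbrs G u)) \<le> 6 * t * n" using arcs by linarith
      then show ?thesis using e(1) by (intro mult_left_mono) auto
    qed
    finally show ?thesis by (simp add: algebra_simps)
  qed
  have deg: "(x v - 217 * e) * n \<le> card (nbrs G v)" if v: "v \<in> ?V" for v
  proof -
    have "(\<Sum>u\<in>nbrs G v. \<Sum>w\<in>nbrs G u \<inter> L. x w) \<le> (\<Sum>u\<in>nbrs G v. \<Sum>w\<in>nbrs G u \<inter> L. 1)"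
      using x L by (intro sum_mono) blast
    also have "\<dots> = real (\<Sum>u\<in>nbrs G v. card (nbrs G u \<inter> L))" by simp
    also have "\<dots> \<le> real (t * card (nbrs G v) + card W * card L)"
      using count[of v] by (simp only: of_nat_le_iff)
    finally have "r\<^sup>2 * x v \<le> t * card (nbrs G v) + card W * card L + 216 * t * e * n"
      using two[OF v] by simp
    moreover have "t * (n - t) * x v \<le> r\<^sup>2 * x v" using r(2) x[OF v] by (intro mult_right_mono) auto
    moreover have "real t * t * x v \<le> real t * t" using x[OF v] by (simp add: mult_left_le)
    ultimately have "t * ((x v - 217 * e) * n) \<le> t * real (card (nbrs G v))"
      using WL by (simp add: algebra_simps)
    then show ?thesis using t by simp
  qed
  \<comment> \<open>The candidates for the hub: if there were fewer than \<open>t\<close> of them, then the weight \<open>d\<close> would be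
    missing from about \<open>n\<close> of the walks of length two that start in \<open>z\<close>.\<close>
  define H where "H = {w \<in> L. 1 - d \<le> x w}"
  have "t \<le> card H"
  proof (rule ccontr)
    assume "\<not> t \<le> card H"
    then have cH: "real (card H) \<le> real t - 1" by linarith
    have fH: "finite H" using fL by (simp add: H_def)
    have fN: "finite (nbrs G z)" using finite_nbrs[OF G] by blast
    have dz: "real (card (nbrs G z)) \<le> n"
      unfolding n using finite_nbrs[OF G] fV by (simp add: card_mono)
    have "(\<Sum>w\<in>nbrs G u \<inter> L. x w) \<le> (1 - d) * card (nbrs G u \<inter> L) + d * card H" for u
    proof -
      have "(\<Sum>w\<in>nbrs G u \<inter> L. x w) \<le> (\<Sum>w\<in>nbrs G u \<inter> L. (1 - d) + (if w \<in> H then d else 0))"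
      proof (rule sum_mono)
        fix w assume w: "w \<in> nbrs G u \<inter> L"
        then have "x w \<le> 1" using x L by blast
        then show "x w \<le> (1 - d) + (if w \<in> H then d else 0)" using w by (auto simp: H_def)
      qed
      also have "\<dots> = (1 - d) * card (nbrs G u \<inter> L) + d * card (nbrs G u \<inter> L \<inter> H)"
        using fL by (simp add: sum.distrib Int_def conj_assoc flip: sum.inter_filter)
      also have "d * card (nbrs G u \<inter> L \<inter> H) \<le> d * card H"
        using d0 fH by (intro mult_left_mono) (auto intro: card_mono)
      finally show ?thesis by simp
    qed
    then have "(\<Sum>u\<in>nbrs G z. \<Sum>w\<in>nbrs G u \<inter> L. x w) \<le>
        (\<Sum>u\<in>nbrs G z. (1 - d) * card (nbrs G u \<inter> L) + d * card H)" by (intro sum_mono)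
    also have "\<dots> = (1 - d) * (\<Sum>u\<in>nbrs G z. card (nbrs G u \<inter> L)) + d * card H * card (nbrs G z)"
      by (simp add: sum.distrib sum_distrib_left)
    also have "\<dots> \<le> (1 - d) * (t * n + card W * card L) + d * (t - 1) * n"
    proof (intro add_mono mult_left_mono)
      have "real (\<Sum>u\<in>nbrs G z. card (nbrs G u \<inter> L)) \<le> real (t * card (nbrs G z) + card W * card L)"
        using count[of z] by (simp only: of_nat_le_iff)
      then show "real (\<Sum>u\<in>nbrs G z. card (nbrs G u \<inter> L)) \<le> t * n + card W * card L"
        using dz mult_left_mono[OF dz, of t] by simp
      have "d * card H * card (nbrs G z) \<le> d * (real t - 1) * n"
        using d0 cH dz n0 by (intro mult_mono mult_left_mono mult_nonneg_nonneg) auto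
      then show "d * card H * card (nbrs G z) \<le> d * (t - 1) * n" using t by (simp add: of_nat_diff)
    qed (use d in auto)
    finally have "(\<Sum>u\<in>nbrs G z. \<Sum>w\<in>nbrs G u \<inter> L. x w) \<le>
        (1 - d) * (t * n + card W * card L) + d * (t - 1) * n" .
    then have "t * (n - t) \<le> (1 - d) * (t * n + card W * card L) + d * (real t - 1) * n + 216 * t * e * n"
      using two[OF z(1)] r(2) z(2) t by (simp add: of_nat_diff)
    moreover have "0 \<le> d * (real (card W) * real (card L))"
      using d0 by simp
    ultimately have "d * n \<le> 217 * t * e * n" using WL by (simp add: algebra_simps)
    then show False using d(1) n0 by simp
  qed
  then obtain T where T: "T \<subseteq> H" "card T = t" by (metis obtain_subset_with_card_n)
  have "1 - d \<le> x v \<and> (1 - 2 * d) * n \<le> card (nbrs G v)" if v: "v \<in> T" for v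
  proof
    show xv: "1 - d \<le> x v" using v T by (auto simp: H_def)
    have "217 * e \<le> 217 * t * e" using t e(1) by simp
    then have "217 * e \<le> d" using d(1) by linarith
    then have "(1 - 2 * d) * n \<le> (x v - 217 * e) * n" using xv n0 by (intro mult_right_mono) auto
    then show "(1 - 2 * d) * n \<le> card (nbrs G v)" using deg[of v] v T L by (force simp: H_def)
  qed
  then show ?thesis using T L by (intro exI[of _ T]) (auto simp: H_def)
qed

section \<open>Mass of a component outside the hub\<close>

text \<open>
  Restrict the eigenvalue equation to the component \<open>C\<close> and take the inner product with \<open>x\<close>.  The hub
  sends at most \<open>2 * t\<close> edges into \<open>C\<close>, so its contribution is at most \<open>2 * t * s\<close>, where
  \<open>s\<close> is the Euclidean norm of \<open>x\<close> on \<open>C\<close>.  By the Cauchy-Schwarz inequality and the density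
  bound the edges inside \<open>C\<close> contribute at most \<open>(r / 2) * s\<^sup>2\<close> when \<open>C\<close> is small
  compared with \<open>r\<^sup>2\<close>.  Hence \<open>s\<close> is at most \<open>4 * t / r\<close>, and Cauchy-Schwarz turns this into
  a bound on the sum.
\<close>

lemma component_mass:
  fixes r :: real and t :: nat
  assumes G: "pair_graph G"
    and dens: "\<And>S. S \<subseteq> pverts G \<Longrightarrow> card (parcs G \<inter> S \<times> S) \<le> 6 * t * card S"
    and eig: "eigenfunction G r x" and r: "r > 0"
    and x: "\<And>v. v \<in> pverts G \<Longrightarrow> 0 \<le> x v \<and> x v \<le> 1"
    and T: "T \<subseteq> pverts G" "card T = t" and t: "t \<ge> 1"
    and noear: "\<And>l p. l \<in> T \<Longrightarrow> ear G l p \<Longrightarrow> set p \<inter> T \<noteq> {}"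
    and v: "v \<in> pverts G - T"
    and small: "1024 * (real t)\<^sup>2 * card (comp_without G T v) \<le> r\<^sup>2"
  shows "(\<Sum>w\<in>comp_without G T v. x w) \<le> 1 / 8"
proof -
  define C where "C = comp_without G T v"
  have CV: "C \<subseteq> pverts G - T" unfolding C_def by (rule comp_without_subset[OF G v])
  have fV: "finite (pverts G)" using pair_graphD(1)[OF G] .
  have fC: "finite C" and fT: "finite T" using CV T(1) fV by (auto intro: finite_subset)
  have x0: "0 \<le> x w" "x w \<le> 1" if "w \<in> C \<union> T" for w using x[of w] that CV T(1) by auto
  define s where "s = sqrt (sq_norm_on C x)"
  have sq0: "sq_norm_on C x \<ge> 0" unfolding sq_norm_on_def by (intro sum_nonneg) auto
  then have s0: "s \<ge> 0" and s2: "s\<^sup>2 = sq_norm_on C x" by (auto simp: s_def)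
  have xs: "x w \<le> s" if "w \<in> C" for w
  proof -
    have "(x w)\<^sup>2 \<le> sq_norm_on C x"
      unfolding sq_norm_on_def using that fC by (intro member_le_sum) auto
    then show ?thesis unfolding s_def by (rule real_le_rsqrt)
  qed
  have split: "r * x w = (\<Sum>u\<in>nbrs G w \<inter> T. x u) + (\<Sum>u\<in>nbrs G w \<inter> C. x u)" if w: "w \<in> C" for w
  proof -
    have "nbrs G w \<subseteq> C \<union> T"
      using comp_without_step[of w G T v] w CV unfolding C_def by blast
    then have "nbrs G w = (nbrs G w \<inter> T) \<union> (nbrs G w \<inter> C)" by blast
    then have "nbr_sum G x w = (\<Sum>u\<in>(nbrs G w \<inter> T) \<union> (nbrs G w \<inter> C). x u)"
      unfolding nbr_sum_def by simp
    also have "\<dots> = (\<Sum>u\<in>nbrs G w \<inter> T. x u) + (\<Sum>u\<in>nbrs G w \<inter> C. x u)"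
      using fC fT CV by (intro sum.union_disjoint) auto
    finally show ?thesis using eig w CV by (auto simp: eigenfunction_def)
  qed
  have "r * s\<^sup>2 = (\<Sum>w\<in>C. x w * (r * x w))"
    unfolding s2 sq_norm_on_def sum_distrib_left by (intro sum.cong) (auto simp: power2_eq_square)
  also have "\<dots> = (\<Sum>w\<in>C. x w * (\<Sum>u\<in>nbrs G w \<inter> T. x u)) + (\<Sum>w\<in>C. x w * (\<Sum>u\<in>nbrs G w \<inter> C. x u))"
    unfolding sum.distrib[symmetric] by (intro sum.cong) (auto simp: split algebra_simps)
  also have "(\<Sum>w\<in>C. x w * (\<Sum>u\<in>nbrs G w \<inter> T. x u)) \<le> 2 * t * s"
  proof -
    have "(\<Sum>w\<in>C. x w * (\<Sum>u\<in>nbrs G w \<inter> T. x u)) \<le> (\<Sum>w\<in>C. \<Sum>u\<in>nbrs G w \<inter> T. s)"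
      unfolding sum_distrib_left
    proof (intro sum_mono)
      fix w u assume "w \<in> C" "u \<in> nbrs G w \<inter> T"
      then have "x w * x u \<le> x w * 1" using x0[of w] x0[of u] by (intro mult_left_mono) auto
      then show "x w * x u \<le> s" using xs[OF \<open>w \<in> C\<close>] by simp
    qed
    also have "\<dots> = s * real (\<Sum>w\<in>C. card (nbrs G w \<inter> T))" by (simp add: sum_distrib_left mult.commute)
    also have "(\<Sum>w\<in>C. card (nbrs G w \<inter> T)) = card (SIGMA w : C. nbrs G w \<inter> T)"
      using fC fT by simp
    also have "\<dots> = card (SIGMA l : T. nbrs G l \<inter> C)"
      using nbrs_sym[OF G]
      by (intro bij_betw_same_card[of prod.swap] bij_betw_byWitness[where f' = prod.swap]) auto
    also have "\<dots> = (\<Sum>l\<in>T. card (nbrs G l \<inter> C))" using fC fT by simp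
    also have "\<dots> \<le> (\<Sum>l\<in>T. 2)"
      unfolding C_def by (intro sum_mono card_nbrs_comp_without[OF G v] noear)
    also have "\<dots> = 2 * t" using T(2) by simp
    finally show ?thesis using s0 by (simp add: mult.commute mult_left_mono)
  qed
  also have "(\<Sum>w\<in>C. x w * (\<Sum>u\<in>nbrs G w \<inter> C. x u)) \<le> r / 2 * s\<^sup>2"
  proof -
    let ?E = "parcs G \<inter> C \<times> C"
    have fE: "finite ?E" using fC by simp
    have "?E = Sigma C (\<lambda>w. nbrs G w \<inter> C)" by (auto simp: nbrs_def)
    then have q: "(\<Sum>w\<in>C. x w * (\<Sum>u\<in>nbrs G w \<inter> C. x u)) = (\<Sum>(w, u)\<in>?E. x w * x u)"
      using fC by (simp add: sum.Sigma sum_distrib_left)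
    have "(\<Sum>(w, u)\<in>?E. x w * x u)\<^sup>2 \<le> (\<Sum>(w, u)\<in>?E. (x w * x u)\<^sup>2) * card ?E"
      using sum_squared_le_sum_of_squares[of "\<lambda>(w, u). x w * x u" ?E] 
      by (simp add: case_prod_unfold)
    also have "(\<Sum>(w, u)\<in>?E. (x w * x u)\<^sup>2) \<le> (\<Sum>(w, u)\<in>C \<times> C. (x w * x u)\<^sup>2)"
      using fC by (intro sum_mono2) auto
    also have "\<dots> = s\<^sup>2 * s\<^sup>2"
      unfolding s2 sq_norm_on_def
      by (simp add: power_mult_distrib sum_product sum.cartesian_product)
    also have "real (card ?E) \<le> (r / 2)\<^sup>2"
    proof -
      have "card ?E \<le> 6 * t * card C" using CV by (intro dens) auto
      then have "real (card ?E) \<le> real (6 * t * card C)" by (simp only: of_nat_le_iff)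
      also have "\<dots> = 6 * (real t * card C)" by simp
      also have "\<dots> \<le> 256 * ((real t)\<^sup>2 * card C)"
        using t mult_right_mono[of "1" "real t" "real t * card C"] by (simp add: power2_eq_square algebra_simps)
      finally show ?thesis using small unfolding C_def by (simp add: power_divide)
    qed
    finally have "(\<Sum>(w, u)\<in>?E. x w * x u)\<^sup>2 \<le> s\<^sup>2 * s\<^sup>2 * (r / 2)\<^sup>2"
      by (simp add: mult_left_mono mult_right_mono)
    also have "\<dots> = (r / 2 * s\<^sup>2)\<^sup>2" by (simp add: power_mult_distrib power2_eq_square)
    finally have "(\<Sum>(w, u)\<in>?E. x w * x u)\<^sup>2 \<le> (r / 2 * s\<^sup>2)\<^sup>2" .
    then show ?thesis unfolding q by (rule power2_le_imp_le) (use r in auto)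
  qed
  finally have "r * s\<^sup>2 \<le> 2 * t * s + r / 2 * s\<^sup>2" by simp
  then have "s * (r * s) \<le> s * (4 * t)" by (simp add: power2_eq_square algebra_simps)
  then have rs: "r * s \<le> 4 * t" using s0 by (cases "s = 0") auto
  have "(\<Sum>w\<in>C. x w)\<^sup>2 \<le> s\<^sup>2 * card C"
    using sum_squared_le_sum_of_squares[of x C] fC unfolding s2 sq_norm_on_def by simp
  then have "r\<^sup>2 * (\<Sum>w\<in>C. x w)\<^sup>2 \<le> (r * s)\<^sup>2 * card C"
    by (simp add: power_mult_distrib mult.assoc mult_left_mono)
  also have "\<dots> \<le> (4 * real t)\<^sup>2 * card C"
    using rs r s0 by (intro mult_right_mono power_mono) auto
  also have "\<dots> \<le> r\<^sup>2 * (1 / 8)\<^sup>2"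
    using small unfolding C_def[symmetric] by (simp add: power_mult_distrib power_divide)
  finally have "(\<Sum>w\<in>C. x w)\<^sup>2 \<le> (1 / 8)\<^sup>2" using r by simp
  then show ?thesis unfolding C_def[symmetric] by (rule power2_le_imp_le) simp
qed

section \<open>The extremal graph\<close>

text \<open>
  Induction on the vertex set: an edge of the given matching takes the numbers \<open>0\<close> and \<open>1\<close>, and
  the numbering of the rest is shifted by two, which maps matching edges to matching edges.  Removing an
  edge from the top end instead would fail for odd \<open>m\<close>.
\<close>

lemma matching_extends:
  assumes "finite U" "card U = m" "M \<subseteq> U \<times> U" "sym M" "irrefl M"
    and "\<And>a b c. (a, b) \<in> M \<Longrightarrow> (a, c) \<in> M \<Longrightarrow> b = c"
  shows "\<exists>g. bij_betw g U {0..<m} \<and> (\<forall>(a, b)\<in>M. (g a, g b) \<in> parcs (matching_graph m))"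
  using assms
proof (induction m arbitrary: U M rule: less_induct)
  case (less m)
  show ?case
  proof (cases "M = {}")
    case True
    then show ?thesis using ex_bij_betw_finite_nat[OF less.prems(1)] less.prems(2) by auto
  next
    case False
    then obtain a b where ab: "(a, b) \<in> M" by auto
    have ba: "(b, a) \<in> M" using ab less.prems(4) by (rule symD[rotated])
    have neq: "a \<noteq> b" using ab less.prems(5) by (auto simp: irrefl_def)
    have U: "a \<in> U" "b \<in> U" using ab less.prems(3) by auto
    let ?U = "U - {a, b}" and ?M = "M \<inter> (U - {a, b}) \<times> (U - {a, b})"
    have "card {a, b} \<le> card U" using U less.prems(1) by (intro card_mono) auto
    then have m2: "2 \<le> m" using neq less.prems(2) by simp
    have cU: "card ?U = m - 2" using U neq less.prems(1,2) by (simp add: card_Diff_subset)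
    have "\<exists>g. bij_betw g ?U {0..<m - 2} \<and> (\<forall>(c, d)\<in>?M. (g c, g d) \<in> parcs (matching_graph (m - 2)))"
    proof (rule less.IH)
      show "sym ?M" using less.prems(4) by (auto simp: sym_def)
      show "irrefl ?M" using less.prems(5) by (auto simp: irrefl_def)
      show "c = d" if "(e, c) \<in> ?M" "(e, d) \<in> ?M" for e c d using that less.prems(6) by blast
    qed (use m2 cU less.prems(1) in simp_all)
    then obtain g where g: "bij_betw g ?U {0..<m - 2}"
      and gM: "\<And>c d. (c, d) \<in> ?M \<Longrightarrow> (g c, g d) \<in> parcs (matching_graph (m - 2))" by blast
    define f where "f u = (if u = a then 0 else if u = b then 1 else g u + 2)" for u
    have "bij_betw f U {0..<m}"
      unfolding bij_betw_def
    proof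
      show "inj_on f U"
      proof (rule inj_onI)
        fix u w assume "u \<in> U" "w \<in> U" "f u = f w"
        then show "u = w"
          using inj_onD[OF bij_betw_imp_inj_on[OF g], of u w]
          by (cases "u \<in> {a, b}"; cases "w \<in> {a, b}") (auto simp: f_def split: if_splits)
      qed
      have "f ` U = {0, 1} \<union> (\<lambda>k. k + 2) ` (g ` ?U)"
        using U neq by (auto simp: f_def image_iff)
      also have "g ` ?U = {0..<m - 2}" using g by (simp add: bij_betw_def)
      also have "{0, 1} \<union> (\<lambda>k. k + 2) ` {0..<m - 2} = {0..<m}"
      proof (intro equalityI subsetI)
        fix k assume "k \<in> {0..<m}"
        then show "k \<in> {0, 1} \<union> (\<lambda>k. k + 2) ` {0..<m - 2}"
          by (cases "k < 2") (auto intro!: image_eqI[of _ _ "k - 2"])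
      qed (use m2 in auto)
      finally show "f ` U = {0..<m}" .
    qed
    moreover have "(f c, f d) \<in> parcs (matching_graph m)" if cd: "(c, d) \<in> M" for c d
    proof -
      have dc: "(d, c) \<in> M" using cd less.prems(4) by (rule symD[rotated])
      consider "c = a" "d = b" | "c = b" "d = a" | "(c, d) \<in> ?M" "c \<notin> {a, b}" "d \<notin> {a, b}"
        using cd dc ab ba less.prems(3,6) by blast
      then show ?thesis
      proof cases
        case 1
        then show ?thesis using m2 neq by (auto simp: f_def matching_graph_def Let_def)
      next
        case 2
        then show ?thesis using m2 neq by (auto simp: f_def matching_graph_def Let_def)
      next
        case 3
        then have "(g c, g d) \<in> parcs (matching_graph (m - 2))" using gM by blast
        then obtain i where i: "i < (m - 2) div 2"
          "(g c, g d) = (2 * i, 2 * i + 1) \<or> (g d, g c) = (2 * i, 2 * i + 1)"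
          by (auto simp: matching_graph_def Let_def)
        have "(f c, f d) = (2 * Suc i, 2 * Suc i + 1) \<or> (f d, f c) = (2 * Suc i, 2 * Suc i + 1)"
          using i(2) 3 by (auto simp: f_def)
        moreover have "Suc i < m div 2" using i(1) m2 by linarith
        ultimately show ?thesis
          unfolding matching_graph_def Let_def pair_pre_digraph.simps by blast
      qed
    qed
    ultimately show ?thesis by blast
  qed
qed

abbreviation (input) extremal_graph :: "nat \<Rightarrow> nat \<Rightarrow> (nat + nat) pair_pre_digraph" where
  "extremal_graph t n \<equiv> graph_join (complete_graph t) (matching_graph (n - t))"

lemma pair_graph_extremal: "pair_graph (extremal_graph t n)"
  by (intro pair_graph_join pair_graph_complete pair_graph_matching)

text \<open>
  The test function is constant on both sides of the complete bipartite subgraph between the clique and the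
  matching, with the two constants chosen such that both sides carry the same squared norm.
\<close>

lemma extremal_spectral_radius_ge:
  assumes "1 \<le> t" "t < n"
  shows "sqrt (real t * (real n - real t)) \<le> \<rho> (extremal_graph t n)"
proof -
  let ?H = "extremal_graph t n"
  define m where "m = n - t"
  define y where "y = (\<lambda>v :: nat + nat. case v of Inl _ \<Rightarrow> sqrt m | Inr _ \<Rightarrow> sqrt t)"
  let ?L = "Inl ` {0..<t} :: (nat + nat) set" and ?R = "Inr ` {0..<m} :: (nat + nat) set"
  have V: "pverts ?H = ?L \<union> ?R"
    by (auto simp: graph_join_def complete_graph_def matching_graph_def Let_def m_def)
  have cLR: "card ?L = t" "card ?R = m" by (auto simp: card_image)
  have sq: "sq_norm_on (pverts ?H) y = 2 * (real t * m)"
  proof -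
    have "sq_norm_on (pverts ?H) y = sq_norm_on ?L y + sq_norm_on ?R y"
      unfolding V sq_norm_on_def by (intro sum.union_disjoint) auto
    also have "\<dots> = 2 * (real t * m)"
      by (simp add: sq_norm_on_def sum.reindex y_def)
    finally show ?thesis .
  qed
  have E: "?L \<times> ?R \<union> ?R \<times> ?L \<subseteq> parcs ?H"
    by (auto simp: graph_join_def complete_graph_def matching_graph_def Let_def m_def)
  have y0: "0 \<le> y v" for v by (auto simp: y_def split: sum.split)
  have "2 * (real t * m) * sqrt (real t * m) = (\<Sum>(v, w)\<in>?L \<times> ?R. y v * y w) + (\<Sum>(v, w)\<in>?R \<times> ?L. y v * y w)"
    by (simp add: sum.cartesian_product[symmetric] sum.reindex y_def real_sqrt_mult algebra_simps)
  also have "\<dots> = (\<Sum>(v, w)\<in>?L \<times> ?R \<union> ?R \<times> ?L. y v * y w)"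
    by (intro sum.union_disjoint[symmetric]) auto
  also have "\<dots> \<le> arc_form ?H y"
    unfolding arc_form_def using E y0 finite_parcs[OF pair_graph_extremal] by (intro sum_mono2) auto
  also have "\<dots> \<le> \<rho> ?H * (2 * (real t * m))"
    using spectral_radius_Rayleigh(1)[OF pair_graph_extremal, of t n y] assms unfolding sq[symmetric]
    by (simp add: V)
  finally have "(2 * (real t * m)) * sqrt (real t * m) \<le> (2 * (real t * m)) * \<rho> ?H" by (simp add: mult.commute)
  moreover have "0 < 2 * (real t * m)" using assms by (simp add: m_def)
  ultimately have "sqrt (real t * m) \<le> \<rho> ?H" by (simp only: mult_le_cancel_left_pos)
  then show ?thesis using assms by (simp add: m_def of_nat_diff)
qed

section \<open>Comparison with the extremal graph\<close>

text \<open>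
  Let \<open>B\<close> be the set of vertices outside \<open>T\<close> that miss some vertex of \<open>T\<close>.  Passing from
  \<open>G\<close> to \<open>H\<close> loses only edges outside \<open>T\<close> that meet \<open>B\<close>; at a vertex \<open>v\<close> of
  \<open>B\<close> they cost at most \<open>2 * x v / 8\<close>, as the entries of its neighbours outside \<open>T\<close> have a small
  sum.  In exchange \<open>v\<close> gains an edge to some \<open>l\<close> in \<open>T\<close>, and already one of its two arcs is worth
  \<open>x v / 2\<close>.
\<close>

lemma compare_forms:
  assumes G: "pair_graph G" and H: "pair_graph H" and VH: "pverts H = pverts G"
    and T: "T \<subseteq> pverts G" and A: "A = {v \<in> pverts G. T \<subseteq> nbrs G v}"
    and x: "\<And>v. v \<in> pverts G \<Longrightarrow> 0 \<le> x v" and xT: "\<And>l. l \<in> T \<Longrightarrow> 1 / 2 \<le> x l"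
    and small: "\<And>v. v \<in> pverts G - T \<Longrightarrow> (\<Sum>w\<in>nbrs G v - T. x w) \<le> 1 / 8"
    and full: "\<And>l v. l \<in> T \<Longrightarrow> v \<in> pverts G \<Longrightarrow> v \<noteq> l \<Longrightarrow> (l, v) \<in> parcs H"
    and inner: "parcs G \<inter> A \<times> A \<subseteq> parcs H"
  shows "arc_form G x + (\<Sum>v\<in>pverts G - T - A. x v) / 4 \<le> arc_form H x"
proof -
  let ?V = "pverts G"
  define B where "B = ?V - T - A"
  have fV: "finite ?V" using pair_graphD(1)[OF G] .
  have fB: "finite B" using fV by (simp add: B_def)
  have fE: "finite (parcs G)" "finite (parcs H)" using finite_parcs G H by blast+
  note GV = pair_graphD(2)[OF G] and HV = pair_graphD(2)[OF H, unfolded VH]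
  let ?w = "\<lambda>(v, w). x v * x w"
  have nonneg: "0 \<le> ?w e" if "e \<in> ?V \<times> ?V" for e using that x by auto
  have full': "(v, l) \<in> parcs H" if "l \<in> T" "v \<in> ?V" "v \<noteq> l" for l v
    using full[OF that] pair_graphD(3)[OF H] by blast
  let ?X = "Sigma B (\<lambda>v. nbrs G v - T)"
  have fX: "finite ?X" using fB finite_nbrs[OF G] by auto
  have X: "(\<Sum>e\<in>?X. ?w e) \<le> (\<Sum>v\<in>B. x v) / 8"
  proof -
    have "(\<Sum>e\<in>?X. ?w e) = (\<Sum>v\<in>B. x v * (\<Sum>w\<in>nbrs G v - T. x w))"
      using fB finite_nbrs[OF G] by (simp add: sum.Sigma sum_distrib_left)
    also have "\<dots> \<le> (\<Sum>v\<in>B. x v * (1 / 8))"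
      using small x by (intro sum_mono mult_left_mono) (auto simp: B_def)
    finally show ?thesis by (simp add: sum_divide_distrib)
  qed
  have lost: "(\<Sum>e\<in>parcs G - parcs H. ?w e) \<le> (\<Sum>v\<in>B. x v) / 4"
  proof -
    have "parcs G - parcs H \<subseteq> ?X \<union> prod.swap ` ?X"
    proof
      fix e assume e: "e \<in> parcs G - parcs H"
      obtain v w where vw: "e = (v, w)" by force
      have V: "v \<in> ?V" "w \<in> ?V" "v \<noteq> w" using e vw GV pair_graphD(4)[OF G] by auto
      have "v \<notin> T" "w \<notin> T" using e vw V full full' by auto
      moreover have "v \<in> B \<or> w \<in> B" using e vw V inner calculation by (auto simp: B_def)
      moreover have "w \<in> nbrs G v" "v \<in> nbrs G w"
        using e vw pair_graphD(3)[OF G] by (auto simp: nbrs_def)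
      ultimately have "(v, w) \<in> ?X \<or> (w, v) \<in> ?X" by blast
      then show "e \<in> ?X \<union> prod.swap ` ?X" unfolding vw by (metis UnI1 UnI2 imageI swap_simp)
    qed
    moreover have XV: "?X \<union> prod.swap ` ?X \<subseteq> ?V \<times> ?V" using GV by (auto simp: B_def nbrs_def)
    ultimately have "(\<Sum>e\<in>parcs G - parcs H. ?w e) \<le> (\<Sum>e\<in>?X \<union> prod.swap ` ?X. ?w e)"
    proof (intro sum_mono2)
      show "0 \<le> ?w e" if "e \<in> (?X \<union> prod.swap ` ?X) - (parcs G - parcs H)" for e
        using that XV by (intro nonneg) blast
    qed (use fX in simp_all)
    also have "\<dots> \<le> (\<Sum>e\<in>?X. ?w e) + (\<Sum>e\<in>prod.swap ` ?X. ?w e)"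
    proof -
      have "0 \<le> (\<Sum>e\<in>?X \<inter> prod.swap ` ?X. ?w e)" using nonneg XV by (intro sum_nonneg) blast
      then show ?thesis using fX by (subst sum_Un) auto
    qed
    also have "(\<Sum>e\<in>prod.swap ` ?X. ?w e) = (\<Sum>e\<in>?X. ?w e)"
      by (subst sum.reindex) (auto simp: case_prod_unfold mult.commute)
    finally show ?thesis using X by simp
  qed
  have gained: "(\<Sum>v\<in>B. x v) / 2 \<le> (\<Sum>e\<in>parcs H - parcs G. ?w e)"
  proof -
    have "\<exists>l\<in>T. l \<notin> nbrs G v" if "v \<in> B" for v using that A by (auto simp: B_def)
    then obtain l where l: "\<And>v. v \<in> B \<Longrightarrow> l v \<in> T" "\<And>v. v \<in> B \<Longrightarrow> l v \<notin> nbrs G v" by metis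
    have "(\<Sum>v\<in>B. x v) / 2 \<le> (\<Sum>v\<in>B. x v * x (l v))"
      unfolding sum_divide_distrib
    proof (rule sum_mono)
      fix v assume "v \<in> B"
      then show "x v / 2 \<le> x v * x (l v)"
        using mult_left_mono[OF xT[OF l(1)[of v]] x[of v]] by (simp add: B_def)
    qed
    also have "\<dots> = (\<Sum>e\<in>(\<lambda>v. (v, l v)) ` B. ?w e)"
      by (subst sum.reindex) (auto simp: inj_on_def)
    also have "\<dots> \<le> (\<Sum>e\<in>parcs H - parcs G. ?w e)"
    proof (rule sum_mono2)
      show "(\<lambda>v. (v, l v)) ` B \<subseteq> parcs H - parcs G"
      proof
        fix e assume "e \<in> (\<lambda>v. (v, l v)) ` B"
        then obtain v where v: "v \<in> B" "e = (v, l v)" by blast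
        then have "(v, l v) \<in> parcs H" using l(1)[of v] by (intro full') (auto simp: B_def)
        then show "e \<in> parcs H - parcs G" using l(2)[of v] v by (simp add: nbrs_def)
      qed
    qed (use fE nonneg HV in blast)+
    finally show ?thesis .
  qed
  have "arc_form G x = (\<Sum>e\<in>parcs G \<inter> parcs H. ?w e) + (\<Sum>e\<in>parcs G - parcs H. ?w e)"
    unfolding arc_form_def using fE(1) by (rule sum.Int_Diff)
  moreover have "arc_form H x = (\<Sum>e\<in>parcs H \<inter> parcs G. ?w e) + (\<Sum>e\<in>parcs H - parcs G. ?w e)"
    unfolding arc_form_def using fE(2) by (rule sum.Int_Diff)
  ultimately show ?thesis using lost gained unfolding B_def by (simp add: Int_commute)
qed

text \<open>
  If \<open>G\<close> does at least as well as \<open>H\<close>, then all inequalities between the two forms are equalities.  So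
  \<open>x\<close> maximises the form of \<open>H\<close> and is an eigenfunction of \<open>H\<close>; as every vertex of
  \<open>T\<close> is adjacent in \<open>H\<close> to all others, \<open>x\<close> is positive everywhere.  Thus no vertex misses
  an edge to \<open>T\<close>, \<open>G\<close> is a subgraph of \<open>H\<close>, and any further arc of \<open>H\<close> would make the
  form strictly larger.
\<close>

lemma graph_eq_if_spectral_radius_ge:
  assumes G: "pair_graph G" and H: "pair_graph H" and VH: "pverts H = pverts G"
    and T: "T \<subseteq> pverts G" "T \<noteq> {}" and A: "A = {v \<in> pverts G. T \<subseteq> nbrs G v}"
    and x: "\<And>v. v \<in> pverts G \<Longrightarrow> 0 \<le> x v" and xT: "\<And>l. l \<in> T \<Longrightarrow> 1 / 2 \<le> x l"
    and small: "\<And>v. v \<in> pverts G - T \<Longrightarrow> (\<Sum>w\<in>nbrs G v - T. x w) \<le> 1 / 8"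
    and full: "\<And>l v. l \<in> T \<Longrightarrow> v \<in> pverts G \<Longrightarrow> v \<noteq> l \<Longrightarrow> (l, v) \<in> parcs H"
    and inner: "parcs G \<inter> A \<times> A \<subseteq> parcs H"
    and eig: "eigenfunction G (\<rho> G) x" and ge: "\<rho> H \<le> \<rho> G"
  shows "G = H"
proof -
  let ?V = "pverts G"
  define b where "b = (\<Sum>v\<in>?V - T - A. x v)"
  have fV: "finite ?V" using pair_graphD(1)[OF G] .
  have ne: "pverts H \<noteq> {}" using T VH by auto
  have b0: "0 \<le> b" unfolding b_def using x by (intro sum_nonneg) auto
  have sq0: "0 \<le> sq_norm_on ?V x" unfolding sq_norm_on_def by (intro sum_nonneg) auto
  have "arc_form G x + b / 4 \<le> arc_form H x"
    unfolding b_def by (rule compare_forms[OF G H VH T(1) A x xT small full inner])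
  moreover have "arc_form G x = \<rho> G * sq_norm_on ?V x" by (rule eigenfunction_arc_form[OF G eig])
  moreover have upper: "arc_form H z \<le> \<rho> H * sq_norm_on ?V z" for z
    using spectral_radius_Rayleigh(1)[OF H ne, of z] VH by simp
  moreover have "\<rho> H * sq_norm_on ?V x \<le> \<rho> G * sq_norm_on ?V x" using ge sq0 by (rule mult_right_mono)
  ultimately have eqs: "b = 0" "arc_form H x = \<rho> H * sq_norm_on ?V x" "arc_form G x = arc_form H x"
    using upper[of x] b0 by linarith+
  have eigH: "eigenfunction H (\<rho> H) x"
    by (rule form_maximiser_eigenfunction[OF H]) (use upper eqs(2) VH in auto)
  have pos: "0 < x v" if v: "v \<in> ?V" for v
  proof (cases "v \<in> T")
    case True
    then show ?thesis using xT[of v] by simp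
  next
    case False
    obtain l where l: "l \<in> T" using T(2) by blast
    have "l \<in> nbrs H v" using full[OF l v] False l pair_graphD(3)[OF H] by (auto simp: nbrs_def)
    then have "x l \<le> nbr_sum H x v"
      unfolding nbr_sum_def using finite_nbrs[OF H, of v] x VH by (intro member_le_sum) auto
    then have "0 < \<rho> H * x v" using eigH v VH xT[OF l] by (auto simp: eigenfunction_def)
    then have "x v \<noteq> 0" by auto
    then show ?thesis using x[OF v] by simp
  qed
  have "?V - T - A = {}"
  proof (rule ccontr)
    assume "?V - T - A \<noteq> {}"
    then have "0 < b" unfolding b_def using fV pos by (intro sum_pos) auto
    then show False using eqs(1) by simp
  qed
  then have VTA: "?V \<subseteq> T \<union> A" by blast
  have sub: "parcs G \<subseteq> parcs H"
  proof
    fix e assume e: "e \<in> parcs G"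
    obtain v w where vw: "e = (v, w)" by force
    have V: "v \<in> ?V" "w \<in> ?V" "v \<noteq> w"
      using e vw pair_graphD(2)[OF G] pair_graphD(4)[OF G] by auto
    consider "v \<in> T" | "w \<in> T" | "v \<in> A" "w \<in> A" using V VTA by blast
    then show "e \<in> parcs H"
      using full[of v w] full[of w v] V inner e pair_graphD(3)[OF H, of w v] unfolding vw
      by cases auto
  qed
  have "arc_form H x = arc_form G x + (\<Sum>(v, w)\<in>parcs H - parcs G. x v * x w)"
    unfolding arc_form_def using sub finite_parcs[OF H]
    by (simp add: sum.subset_diff add.commute)
  then have zero: "(\<Sum>(v, w)\<in>parcs H - parcs G. x v * x w) = 0" using eqs(3) by simp
  have "parcs H - parcs G = {}"
  proof (rule ccontr)
    assume "parcs H - parcs G \<noteq> {}"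
    then have "0 < (\<Sum>(v, w)\<in>parcs H - parcs G. x v * x w)"
      using finite_parcs[OF H] pos pair_graphD(2)[OF H] VH by (intro sum_pos) auto
    then show False using zero by simp
  qed
  then show "G = H" using sub VH by (auto intro: pair_pre_digraph.equality)
qed

text \<open>
  A common neighbour \<open>a\<close> of the hub with two such neighbours \<open>b\<close> and \<open>c\<close> would be the middle of an
  ear.
\<close>

lemma ears_avoid_imp_matching:
  assumes G: "pair_graph G" and A: "A \<subseteq> {v \<in> pverts G. T \<subseteq> nbrs G v}" "A \<inter> T = {}" and l: "l \<in> T"
    and noear: "\<And>p. ear G l p \<Longrightarrow> set p \<inter> T \<noteq> {}"
    and ab: "(a, b) \<in> parcs G \<inter> A \<times> A" "(a, c) \<in> parcs G \<inter> A \<times> A"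
  shows "b = c"
proof (rule ccontr)
  assume "b \<noteq> c"
  have "ear G l [b, a, c]"
    using ab \<open>b \<noteq> c\<close> A(1) l pair_graphD(3)[OF G] pair_graphD(4)[OF G] nbrs_sym[OF G]
    by (auto simp: ear_def is_path_def nbrs_def)
  then show False using noear[of "[b, a, c]"] ab A(2) by auto
qed

text \<open>
  The vertices of \<open>G\<close> can be identified with those of the extremal graph such that \<open>T\<close> becomes
  the clique and a prescribed matching outside \<open>T\<close> becomes part of the matching.
\<close>

lemma extremal_embedding:
  assumes G: "pair_graph G" and n: "card (pverts G) = n"
    and T: "T \<subseteq> pverts G" "card T = t"
    and M: "M \<subseteq> (pverts G - T) \<times> (pverts G - T)" "sym M" "irrefl M"
      "\<And>a b c. (a, b) \<in> M \<Longrightarrow> (a, c) \<in> M \<Longrightarrow> b = c"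
  shows "\<exists>f. bij_betw f (pverts G) (pverts (extremal_graph t n)) \<and>
    (\<forall>l\<in>T. \<forall>v\<in>pverts G. v \<noteq> l \<longrightarrow> (f l, f v) \<in> parcs (extremal_graph t n)) \<and>
    (\<forall>(a, b)\<in>M. (f a, f b) \<in> parcs (extremal_graph t n))"
proof -
  let ?V = "pverts G" and ?H = "extremal_graph t n"
  have fV: "finite ?V" using pair_graphD(1)[OF G] .
  have fT: "finite T" using T(1) fV finite_subset by blast
  have cU: "card (?V - T) = n - t" using fT T n by (simp add: card_Diff_subset)
  obtain h where h: "bij_betw h T {0..<t}" using ex_bij_betw_finite_nat[OF fT] T(2) by blast
  have "\<exists>g. bij_betw g (?V - T) {0..<n - t} \<and> (\<forall>(a, b)\<in>M. (g a, g b) \<in> parcs (matching_graph (n - t)))"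
    using fV by (intro matching_extends cU M(1-3)) (auto dest: M(4))
  then obtain g where g: "bij_betw g (?V - T) {0..<n - t}"
    and gM: "\<And>a b. (a, b) \<in> M \<Longrightarrow> (g a, g b) \<in> parcs (matching_graph (n - t))" by blast
  define f :: "'a \<Rightarrow> nat + nat" where "f v = (if v \<in> T then Inl (h v) else Inr (g v))" for v
  have VH: "pverts ?H = Inl ` {0..<t} \<union> Inr ` {0..<n - t}"
    by (auto simp: graph_join_def complete_graph_def matching_graph_def Let_def)
  have "bij_betw f (T \<union> (?V - T)) (Inl ` {0..<t} \<union> Inr ` {0..<n - t})"
  proof (rule bij_betw_combine)
    have "bij_betw (Inl \<circ> h) T (Inl ` {0..<t})"
      using h by (rule bij_betw_trans) (auto simp: bij_betw_def)
    then show "bij_betw f T (Inl ` {0..<t})" by (rule bij_betw_cong[THEN iffD1, rotated]) (simp add: f_def)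
    have "bij_betw (Inr \<circ> g) (?V - T) (Inr ` {0..<n - t})"
      using g by (rule bij_betw_trans) (auto simp: bij_betw_def)
    then show "bij_betw f (?V - T) (Inr ` {0..<n - t})" by (rule bij_betw_cong[THEN iffD1, rotated]) (simp add: f_def)
  qed auto
  then have bij: "bij_betw f ?V (pverts ?H)" using T(1) VH by (simp add: Un_absorb1)
  moreover have "(f l, f v) \<in> parcs ?H" if lv: "l \<in> T" "v \<in> ?V" "v \<noteq> l" for l v
  proof (cases "v \<in> T")
    case True
    then have "h l \<noteq> h v" using lv bij_betw_imp_inj_on[OF h] by (auto dest: inj_onD)
    then show ?thesis using True lv bij_betwE[OF h]
      by (force simp: f_def graph_join_def complete_graph_def)
  next
    case False
    then show ?thesis using lv bij_betwE[OF h] bij_betwE[OF g]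
      by (auto simp: f_def graph_join_def complete_graph_def matching_graph_def Let_def)
  qed
  moreover have "(f a, f b) \<in> parcs ?H" if ab: "(a, b) \<in> M" for a b
  proof -
    have "f a = Inr (g a)" "f b = Inr (g b)" using ab M(1) by (auto simp: f_def)
    then show ?thesis using gM[OF ab] by (force simp: graph_join_def)
  qed
  ultimately show ?thesis by blast
qed

text \<open>
  Transporting \<open>H\<close> to the vertex set of \<open>G\<close> allows both forms to be evaluated at the same function.
\<close>

lemma pullback_graph:
  assumes H: "pair_graph H" and bij: "bij_betw f V (pverts H)" and fV: "finite V"
    and H': "H' = \<lparr> pverts = V, parcs = {(u, v). u \<in> V \<and> v \<in> V \<and> (f u, f v) \<in> parcs H} \<rparr>"
  shows "pair_graph H'" "H' \<cong>\<^sub>g H"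
proof -
  show pg: "pair_graph H'"
    unfolding H' using fV pair_graphD(3,4)[OF H] by (intro pair_graphI) auto
  show "H' \<cong>\<^sub>g H"
    unfolding graph_iso_iff[OF pg H] using bij by (intro exI[of _ f]) (auto simp: H')
qed

lemma normalised_Perron_function:
  assumes G: "pair_graph G" and ne: "pverts G \<noteq> {}"
  obtains x z where "eigenfunction G (\<rho> G) x" "\<And>v. v \<in> pverts G \<Longrightarrow> 0 \<le> x v \<and> x v \<le> 1"
    "z \<in> pverts G" "x z = 1"
proof -
  have fV: "finite (pverts G)" using pair_graphD(1)[OF G] .
  obtain y where y: "\<forall>v\<in>pverts G. 0 \<le> y v" "\<exists>v\<in>pverts G. 0 < y v" "eigenfunction G (\<rho> G) y"
    using spectral_radius_Rayleigh(2)[OF G ne] by blast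
  define m where "m = Max (y ` pverts G)"
  have "m \<in> y ` pverts G" unfolding m_def using fV ne by (intro Max_in) auto
  then obtain z where z: "z \<in> pverts G" "m = y z" by blast
  have le: "y v \<le> m" if "v \<in> pverts G" for v unfolding m_def using fV that by (intro Max_ge) auto
  have m: "0 < m" using y(2) le by fastforce
  show thesis
  proof (rule that[of "\<lambda>v. y v / m" z])
    show "eigenfunction G (\<rho> G) (\<lambda>v. y v / m)"
      using y(3) by (simp add: eigenfunction_def nbr_sum_def flip: sum_divide_distrib)
    show "0 \<le> y v / m \<and> y v / m \<le> 1" if "v \<in> pverts G" for v
      using y(1) le[OF that] m that by simp
  qed (use z m in auto)
qed

text \<open>
  The value of \<open>d\<close> is small enough that all but \<open>n / (4096 * t)\<close> vertices are common neighbours of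
  the hub, which makes the components outside the hub as small as the mass bound requires.
\<close>

lemma iso_extremal_if_spectral_radius_ge:
  fixes e d :: real and t l n :: nat
  assumes G: "pair_graph G" and n: "card (pverts G) = n" and free: "minor_free (Q_graph t) G"
    and ge: "\<rho> (extremal_graph t n) \<le> \<rho> G"
    and t: "1 \<le> t" and e: "0 < e" "217 * t * e < d" and d: "d = 1 / (8192 * (real t)\<^sup>2)"
    and l: "6 * t \<le> e * real l"
    and n_large: "8192 * t \<le> n" "6 * t \<le> e\<^sup>2 * sqrt (t * (real n - t))"
      "real t * t + 2 ^ l * (2 * t) * l \<le> t * e * n"
  shows "G \<cong>\<^sub>g extremal_graph t n"
proof -
  let ?V = "pverts G" and ?H = "extremal_graph t n"
  have fV: "finite ?V" using pair_graphD(1)[OF G] .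
  have nt: "real n \<ge> 8192 * t" using n_large(1) by (metis of_nat_le_iff of_nat_mult of_nat_numeral)
  have n0: "0 < n" "t < n" using n_large(1) t by auto
  have ne: "?V \<noteq> {}" using n n0 by auto
  have noflower: "length ps \<noteq> t" if "flower G v ps" for v ps
  proof
    assume "length ps = t"
    moreover from this have "ps \<noteq> []" using t by auto
    ultimately show False using flower_imp_Q_minor[OF G that] free by (simp add: minor_free_def)
  qed
  have dens: "card (parcs G \<inter> S \<times> S) \<le> 6 * t * card S" if "S \<subseteq> ?V" for S
    by (rule arcs_within_bound[OF G noflower that])
  have common: "card A < 2 * t" if "T \<subseteq> ?V" "card T = Suc t" "\<And>m. m \<in> T \<Longrightarrow> A \<subseteq> nbrs G m" for T A
    using common_nbrs_imp_flower[OF G that(1,2,3)] noflower by (meson not_le)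
  define r where "r = \<rho> G"
  have r_ge: "sqrt (t * (real n - t)) \<le> r"
    using extremal_spectral_radius_ge[OF t n0(2)] ge by (simp add: r_def)
  have tn: "0 < t * (real n - t)" using t n0 by simp
  then have r0: "0 < r" using r_ge real_sqrt_gt_zero[OF tn] by linarith
  have r2: "t * (real n - t) \<le> r\<^sup>2"
    using power_mono[OF r_ge, of 2] tn by simp
  obtain x z where eig: "eigenfunction G r x" and x: "\<And>v. v \<in> ?V \<Longrightarrow> 0 \<le> x v \<and> x v \<le> 1"
    and z: "z \<in> ?V" "x z = 1"
    using normalised_Perron_function[OF G ne] unfolding r_def by blast
  have d1: "d \<le> 1 / 8192"
    using t unfolding d by (simp add: divide_simps) 
  have "6 * t \<le> e\<^sup>2 * r"
    using n_large(2) mult_left_mono[OF r_ge, of "e\<^sup>2"] by simp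
  then have "\<exists>T \<subseteq> ?V. card T = t \<and> (\<forall>v\<in>T. 1 - d \<le> x v \<and> (1 - 2 * d) * n \<le> card (nbrs G v))"
    using nt d1 n by (intro exists_hub[OF G dens common eig x z r0 r2 _ t e(1) _ e(2) _ l _ n_large(3)]) simp_all
  then obtain T where T: "T \<subseteq> ?V" "card T = t"
    and xT: "\<And>v. v \<in> T \<Longrightarrow> 1 - d \<le> x v" and degT: "\<And>v. v \<in> T \<Longrightarrow> (1 - 2 * d) * n \<le> card (nbrs G v)"
    by blast
  have fT: "finite T" using T(1) fV finite_subset by blast
  obtain l0 where l0: "l0 \<in> T" using T(2) t by fastforce
  define A where "A = {v \<in> ?V. T \<subseteq> nbrs G v}"
  have AN: "A \<subseteq> nbrs G m" if "m \<in> T" for m using that nbrs_sym[OF G] by (auto simp: A_def)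
  have AT: "A \<inter> T = {}" using AN not_self_nbr[OF G] by blast
  have cVA: "card (?V - A) \<le> 2 * t * d * n"
  proof -
    have "?V - A \<subseteq> (\<Union>m\<in>T. ?V - nbrs G m)" using nbrs_sym[OF G] by (auto simp: A_def)
    then have "card (?V - A) \<le> card (\<Union>m\<in>T. ?V - nbrs G m)" using fT fV by (intro card_mono) auto
    also have "\<dots> \<le> (\<Sum>m\<in>T. card (?V - nbrs G m))" using fT by (rule card_UN_le)
    finally have "real (card (?V - A)) \<le> (\<Sum>m\<in>T. real (card (?V - nbrs G m)))"
      by (metis of_nat_le_iff of_nat_sum)
    also have "\<dots> \<le> (\<Sum>m\<in>T. 2 * d * n)"
    proof (rule sum_mono)
      fix m assume "m \<in> T"
      have "card (?V - nbrs G m) = n - card (nbrs G m)"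
        using finite_nbrs[OF G] n by (simp add: card_Diff_subset)
      moreover have "card (nbrs G m) \<le> n" using finite_nbrs(2)[OF G] fV n card_mono by metis
      ultimately show "real (card (?V - nbrs G m)) \<le> 2 * d * n"
        using degT[OF \<open>m \<in> T\<close>] by (simp add: of_nat_diff algebra_simps)
    qed
    also have "\<dots> = 2 * t * d * n" using T(2) by simp
    finally show ?thesis .
  qed
  have td: "t * d \<le> 1 / 8192"
    using t unfolding d by (simp add: power2_eq_square)
  have cA: "2 * t + 1 \<le> card A"
  proof -
    have "card ?V = card A + card (?V - A)"
      using card_Un_disjoint[of A "?V - A"] fV by (simp add: A_def Un_absorb1)
    then have "real n = card A + real (card (?V - A))" using n by simp
    moreover have "2 * t * d * n \<le> 2 * (1 / 8192) * n" using td by (intro mult_right_mono) auto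
    moreover have "1 \<le> real t" using t by simp
    ultimately have "2 * real t + 1 \<le> real (card A)" using cVA nt by linarith
    then have "real (2 * t + 1) \<le> real (card A)" by simp
    then show ?thesis by (simp only: of_nat_le_iff)
  qed
  have noear: "set p \<inter> T \<noteq> {}" if "m \<in> T" "ear G m p" for m p
    using ear_avoiding_hub_imp_flower[OF G T that(1) AN cA that(2)] noflower by blast
  have comp_small: "1024 * (real t)\<^sup>2 * card (comp_without G T v) \<le> r\<^sup>2" if v: "v \<in> ?V - T" for v
  proof -
    let ?C = "comp_without G T v"
    have CV: "?C \<subseteq> ?V" using comp_without_subset[OF G v] by blast
    have "?C \<subseteq> (nbrs G l0 \<inter> ?C) \<union> (?V - A)" using CV AN[OF l0] by blast
    then have "card ?C \<le> card ((nbrs G l0 \<inter> ?C) \<union> (?V - A))"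
      using fV finite_nbrs[OF G] by (intro card_mono) auto
    also have "\<dots> \<le> card (nbrs G l0 \<inter> ?C) + card (?V - A)" by (rule card_Un_le)
    also have "card (nbrs G l0 \<inter> ?C) \<le> 2"
      using noear[OF l0] by (intro card_nbrs_comp_without[OF G v])
    finally have "card ?C \<le> 2 + card (?V - A)" by simp
    then have "real (card ?C) \<le> 2 + 2 * t * d * n" using cVA by linarith
    then have "1024 * (real t)\<^sup>2 * card ?C \<le> 1024 * (real t)\<^sup>2 * (2 + 2 * t * d * n)"
      by (intro mult_left_mono) auto
    also have "\<dots> = t * (2048 * t + n / 4)"
      using t unfolding d by (simp add: field_simps power2_eq_square)
    also have "\<dots> \<le> t * (real n - t)" using nt by (intro mult_left_mono) auto
    finally show ?thesis using r2 by linarith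
  qed
  have small: "(\<Sum>w\<in>nbrs G v - T. x w) \<le> 1 / 8" if v: "v \<in> ?V - T" for v
  proof -
    let ?C = "comp_without G T v"
    have CV: "?C \<subseteq> ?V" using comp_without_subset[OF G v] by blast
    have "v \<in> ?C" by (simp add: comp_without_def)
    then have "nbrs G v - T \<subseteq> ?C" using comp_without_step[of v G T v] v by blast
    then have "(\<Sum>w\<in>nbrs G v - T. x w) \<le> (\<Sum>w\<in>?C. x w)"
      using CV fV x by (intro sum_mono2) (auto intro: finite_subset)
    also have "\<dots> \<le> 1 / 8"
      by (rule component_mass[OF G dens eig r0 x T t noear v comp_small[OF v]])
    finally show ?thesis .
  qed
  let ?M = "parcs G \<inter> A \<times> A"
  have "\<exists>f. bij_betw f ?V (pverts ?H) \<and>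
    (\<forall>l\<in>T. \<forall>v\<in>?V. v \<noteq> l \<longrightarrow> (f l, f v) \<in> parcs ?H) \<and> (\<forall>(a, b)\<in>?M. (f a, f b) \<in> parcs ?H)"
  proof (rule extremal_embedding[OF G n T])
    show "?M \<subseteq> (?V - T) \<times> (?V - T)" using AT by (auto simp: A_def)
    show "sym ?M" using pair_graphD(3)[OF G] by (auto simp: sym_def)
    show "irrefl ?M" using pair_graphD(4)[OF G] by (auto simp: irrefl_def)
    show "b = c" if "(a, b) \<in> ?M" "(a, c) \<in> ?M" for a b c
      by (rule ears_avoid_imp_matching[OF G _ AT l0 noear[OF l0] that]) (simp add: A_def)
  qed
  then obtain f where f: "bij_betw f ?V (pverts ?H)"
    and fT': "\<And>l v. l \<in> T \<Longrightarrow> v \<in> ?V \<Longrightarrow> v \<noteq> l \<Longrightarrow> (f l, f v) \<in> parcs ?H"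
    and fM0: "\<forall>(a, b)\<in>?M. (f a, f b) \<in> parcs ?H" by blast
  have fM: "(f a, f b) \<in> parcs ?H" if "(a, b) \<in> ?M" for a b using bspec[OF fM0 that] by simp
  define H' where "H' = \<lparr> pverts = ?V, parcs = {(u, v). u \<in> ?V \<and> v \<in> ?V \<and> (f u, f v) \<in> parcs ?H} \<rparr>"
  have H': "pair_graph H'" and iso: "H' \<cong>\<^sub>g ?H"
    using pullback_graph[OF pair_graph_extremal f fV H'_def] by blast+
  have "G = H'"
  proof (rule graph_eq_if_spectral_radius_ge[OF G H' _ T(1) _ A_def, of x])
    show "1 / 2 \<le> x m" if "m \<in> T" for m using xT[OF that] d1 by simp
    show "(m, v) \<in> parcs H'" if "m \<in> T" "v \<in> ?V" "v \<noteq> m" for m v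
      using fT'[OF that] that T(1) by (auto simp: H'_def)
    show "?M \<subseteq> parcs H'" using fM by (auto simp: H'_def A_def)
    show "\<rho> H' \<le> \<rho> G" using spectral_radius_iso[OF H' pair_graph_extremal iso] ge by simp
  qed (use l0 x small eig r_def H'_def in auto)
  then show ?thesis using iso by simp
qed

theorem theorem1p5:
  fixes t :: nat
  assumes "t \<ge> 1"
  shows "\<exists>n\<^sub>0. \<forall>n\<ge>n\<^sub>0. \<forall>G :: 'a pair_pre_digraph.
           pair_graph G \<and> card (pverts G) = n \<and> minor_free (Q_graph t) G \<longrightarrow>
             \<rho> G \<le> \<rho> (graph_join (complete_graph t) (matching_graph (n - t))) \<and>
             (\<rho> G = \<rho> (graph_join (complete_graph t) (matching_graph (n - t))) \<longleftrightarrow>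
                G \<cong>\<^sub>g graph_join (complete_graph t) (matching_graph (n - t)))"
proof -
  define d :: real where "d = 1 / (8192 * (real t)\<^sup>2)"
  \<comment> \<open>Any value with \<open>217 * t * e < d\<close> serves.\<close>
  define e :: real where "e = d / (218 * t)"
  have d: "0 < d" using assms by (simp add: d_def)
  have e: "0 < e" "217 * t * e < d" using d assms by (auto simp: e_def field_simps)
  obtain l :: nat where "6 * t / e \<le> l" using real_arch_simple by blast
  then have l: "6 * t \<le> e * real l" using e(1) by (simp add: field_simps)
  \<comment> \<open>The bound \<open>n1\<close> makes the spectral radius large enough for few entries to exceed \<open>e\<close>,
    and \<open>n2\<close> makes the terms that do not grow with \<open>n\<close> negligible.\<close>
  obtain n1 :: nat where n1: "(6 * t / e\<^sup>2)\<^sup>2 \<le> n1" using real_arch_simple by blast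
  obtain n2 :: nat where n2: "(real t * t + 2 ^ l * (2 * t) * l) / (t * e) \<le> n2"
    using real_arch_simple by blast
  show ?thesis
  proof (intro exI[of _ "8192 * t + n1 + n2"] allI impI)
    fix n and G :: "'a pair_pre_digraph"
    let ?H = "extremal_graph t n"
    assume n: "8192 * t + n1 + n2 \<le> n"
      and "pair_graph G \<and> card (pverts G) = n \<and> minor_free (Q_graph t) G"
    then have G: "pair_graph G" "card (pverts G) = n" "minor_free (Q_graph t) G" by auto
    have a: "6 * t \<le> e\<^sup>2 * sqrt (t * (real n - t))"
    proof -
      have "(6 * t / e\<^sup>2)\<^sup>2 \<le> real n - t" using n1 n assms by linarith
      also have "\<dots> \<le> t * (real n - t)"
        using assms n mult_right_mono[of 1 "real t" "real n - t"] by simp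
      finally have "6 * t / e\<^sup>2 \<le> sqrt (t * (real n - t))" by (rule real_le_rsqrt)
      then show ?thesis using e(1) by (simp add: divide_le_eq mult.commute)
    qed
    have b: "real t * t + 2 ^ l * (2 * t) * l \<le> t * e * n"
    proof -
      have "(real t * t + 2 ^ l * (2 * t) * l) / (t * e) \<le> n" using n2 n by linarith
      then show ?thesis using e(1) assms by (simp add: divide_le_eq mult.commute)
    qed
    have key: "G \<cong>\<^sub>g ?H" if "\<rho> ?H \<le> \<rho> G"
      using iso_extremal_if_spectral_radius_ge[OF G that assms e d_def l _ a b] n by simp
    have "\<rho> G = \<rho> ?H" if "G \<cong>\<^sub>g ?H"
      using spectral_radius_iso[OF G(1) pair_graph_extremal that] .
    then show "\<rho> G \<le> \<rho> ?H \<and> (\<rho> G = \<rho> ?H \<longleftrightarrow> G \<cong>\<^sub>g ?H)" using key by force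
  qed
qed

end
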